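(* Let $\mathbf{k}$ be a field, $A$ a (not necessarily commutative) noetherian domain which is a $\mathbf{k}$-algebra, $\mathcal{G}$ a Lie algebra over $\mathbf{k}$ with universal enveloping algebra $U\mathcal{G}$, and $B=A\star U\mathcal{G}$ a crossed product (all rings being assumed to have the IBN property). Suppose there exist a nonzero element $g\in\mathcal{G}$ and elements $r,q\in A$, with $r$ a non-unit, such that $(r,\,g+q)$ is a unimodular row in the subalgebra $A_1=A[g,\delta]$ of $B$ (where $\delta=\delta_g$ and $g$ is identified with $\bar g\in B$), i.e. $rA_1+(g+q)A_1=A_1$. Then the right ideal $rB\cap(g+q)B$ of $B$ is a stably free, non-free right $B$-module.
   Context: All rings are unital, all modules are unital, and all rings are assumed to have the invariant basis number (IBN) property. Crossed product: let $A$ be a $\mathbf{k}$-algebra and $\mathcal{G}$ a Lie algebra over $\mathbf{k}$ with a (totally ordered) basis $\{g_i\mid i\in I\}$. A $\mathbf{k}$-algebra $B$ containing $A$ is called a crossed product, denoted $A\star U\mathcal{G}$, if there is an embedding of linear spaces $\mathcal{G}\hookrightarrow B$, $g\mapsto\bar g$, such that: (1) $\bar g r-r\bar g\in A$ for all $g\in\mathcal{G}$, $r\in A$, and $\delta_g(r):=\bar g r-r\bar g$ is a derivation of $A$; (2) $\bar g\bar h-\bar h\bar g\equiv\overline{[g,h]}$ modulo $A$ for all $g,h\in\mathcal{G}$; (3) $B$ is a free (right) $A$-module with the commutative (i.e. ordered) monomials $\bar g_1^{j_1}\cdots\bar g_m^{j_m}$ in the $g_i$, $i\in I$, as a basis.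 For a nonzero $g\in\mathcal{G}$, $A[g,\delta_g]$ denotes the subalgebra of $B$ generated by $A$ and $\bar g$; it consists of the sums $\sum_i a_i\bar g^i$ with $a_i\in A$ and is isomorphic to the differential Ore extension of $A$ by $\delta_g$. A finitely generated module $M$ over a ring $R$ is stably free if $M\oplus R^n\cong R^m$ for some nonnegative integers $n,m$; it is non-trivial stably free if moreover it is not free. *)

theory Defs
  imports Complex_Main "HOL-Library.Multiset" "HOL-Library.Function_Algebras" "HOL-Library.Product_Plus"
begin

(* The rings in play all live inside one ambient ring, so a ring is a subset R of a type of
   class ring_1 with is_subring R; the ambient ring itself is UNIV. *)

definition is_subring :: "'r::ring_1 set \<Rightarrow> bool" where
  "is_subring R \<longleftrightarrow> 1 \<in> R \<and> (\<forall>x\<in>R. \<forall>y\<in>R. x - y \<in> R \<and> x * y \<in> R)"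

definition domain_on :: "'r::ring_1 set \<Rightarrow> bool" where
  "domain_on R \<longleftrightarrow> is_subring R \<and> (\<forall>x\<in>R. \<forall>y\<in>R. x * y = 0 \<longrightarrow> x = 0 \<or> y = 0)"

definition unit_in :: "'r::ring_1 set \<Rightarrow> 'r \<Rightarrow> bool" where
  "unit_in R x \<longleftrightarrow> x \<in> R \<and> (\<exists>y\<in>R. x * y = 1 \<and> y * x = 1)"

definition right_ideal :: "'r::ring_1 set \<Rightarrow> 'r set \<Rightarrow> bool" where
  "right_ideal R J \<longleftrightarrow>
     J \<subseteq> R \<and> 0 \<in> J \<and> (\<forall>x\<in>J. \<forall>y\<in>J. x - y \<in> J) \<and> (\<forall>x\<in>J. \<forall>a\<in>R. x * a \<in> J)"

definition left_ideal :: "'r::ring_1 set \<Rightarrow> 'r set \<Rightarrow> bool" where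
  "left_ideal R J \<longleftrightarrow>
     J \<subseteq> R \<and> 0 \<in> J \<and> (\<forall>x\<in>J. \<forall>y\<in>J. x - y \<in> J) \<and> (\<forall>x\<in>J. \<forall>a\<in>R. a * x \<in> J)"

definition ascending_chain_condition :: "('a set \<Rightarrow> bool) \<Rightarrow> bool" where
  "ascending_chain_condition P \<longleftrightarrow>
     (\<forall>J :: nat \<Rightarrow> 'a set. (\<forall>n. P (J n)) \<and> (\<forall>n. J n \<subseteq> J (Suc n)) \<longrightarrow> (\<exists>N. \<forall>n\<ge>N. J n = J N))"

(* two-sided, as usual for noncommutative rings: left and right noetherian *)
definition noetherian_on :: "'r::ring_1 set \<Rightarrow> bool" where
  "noetherian_on R \<longleftrightarrow>
     ascending_chain_condition (right_ideal R) \<and> ascending_chain_condition (left_ideal R)"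

locale right_module =
  fixes R :: "'r::ring_1 set"
    and M :: "'m::ab_group_add set"
    and act :: "'m \<Rightarrow> 'r \<Rightarrow> 'm"
  assumes subring: "is_subring R"
    and zero_closed: "0 \<in> M"
    and diff_closed: "\<lbrakk>x \<in> M; y \<in> M\<rbrakk> \<Longrightarrow> x - y \<in> M"
    and act_closed: "\<lbrakk>x \<in> M; a \<in> R\<rbrakk> \<Longrightarrow> act x a \<in> M"
    and act_add_left: "\<lbrakk>x \<in> M; y \<in> M; a \<in> R\<rbrakk> \<Longrightarrow> act (x + y) a = act x a + act y a"
    and act_add_right: "\<lbrakk>x \<in> M; a \<in> R; b \<in> R\<rbrakk> \<Longrightarrow> act x (a + b) = act x a + act x b"
    and act_mult: "\<lbrakk>x \<in> M; a \<in> R; b \<in> R\<rbrakk> \<Longrightarrow> act x (a * b) = act (act x a) b"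
    and act_one: "x \<in> M \<Longrightarrow> act x 1 = x"

definition module_iso ::
  "'r::ring_1 set \<Rightarrow> 'm::ab_group_add set \<Rightarrow> ('m \<Rightarrow> 'r \<Rightarrow> 'm) \<Rightarrow>
     'n::ab_group_add set \<Rightarrow> ('n \<Rightarrow> 'r \<Rightarrow> 'n) \<Rightarrow> bool" where
  "module_iso R M actM N actN \<longleftrightarrow>
     (\<exists>f. bij_betw f M N \<and>
          (\<forall>x\<in>M. \<forall>y\<in>M. f (x + y) = f x + f y) \<and>
          (\<forall>x\<in>M. \<forall>a\<in>R. f (actM x a) = actN (f x) a))"

(* R^n, as the sequences supported in {..<n} with entries in R *)
definition free_pow :: "'r::ring_1 set \<Rightarrow> nat \<Rightarrow> (nat \<Rightarrow> 'r) set" where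
  "free_pow R n = {v. (\<forall>i<n. v i \<in> R) \<and> (\<forall>i\<ge>n. v i = 0)}"

definition pow_act :: "(nat \<Rightarrow> 'r::ring_1) \<Rightarrow> 'r \<Rightarrow> nat \<Rightarrow> 'r" where
  "pow_act v a = (\<lambda>i. v i * a)"

definition sum_act ::
  "('m \<Rightarrow> 'r \<Rightarrow> 'm) \<Rightarrow> ('n \<Rightarrow> 'r \<Rightarrow> 'n) \<Rightarrow> 'm \<times> 'n \<Rightarrow> 'r \<Rightarrow> 'm \<times> 'n" where
  "sum_act actM actN p a = (actM (fst p) a, actN (snd p) a)"

definition invariant_basis_number :: "'r::ring_1 set \<Rightarrow> bool" where
  "invariant_basis_number R \<longleftrightarrow>
     (\<forall>n m. module_iso R (free_pow R n) pow_act (free_pow R m) pow_act \<longrightarrow> n = m)"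

definition right_module_basis ::
  "'r::ring_1 set \<Rightarrow> 'm::ab_group_add set \<Rightarrow> ('m \<Rightarrow> 'r \<Rightarrow> 'm) \<Rightarrow> 'j set \<Rightarrow> ('j \<Rightarrow> 'm) \<Rightarrow> bool" where
  "right_module_basis R M act J b \<longleftrightarrow>
     b ` J \<subseteq> M \<and>
     (\<forall>x\<in>M. \<exists>!c. (\<forall>j\<in>J. c j \<in> R) \<and> (\<forall>j. j \<notin> J \<longrightarrow> c j = 0) \<and> finite {j. c j \<noteq> 0} \<and>
                  x = (\<Sum>j | c j \<noteq> 0. act (b j) (c j)))"

definition free_module ::
  "'r::ring_1 set \<Rightarrow> 'm::ab_group_add set \<Rightarrow> ('m \<Rightarrow> 'r \<Rightarrow> 'm) \<Rightarrow> bool" where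
  "free_module R M act \<longleftrightarrow>
     right_module R M act \<and> (\<exists>X. right_module_basis R M act X (\<lambda>x. x))"

definition finitely_generated_module ::
  "'r::ring_1 set \<Rightarrow> 'm::ab_group_add set \<Rightarrow> ('m \<Rightarrow> 'r \<Rightarrow> 'm) \<Rightarrow> bool" where
  "finitely_generated_module R M act \<longleftrightarrow>
     right_module R M act \<and>
     (\<exists>S. finite S \<and> S \<subseteq> M \<and> (\<forall>x\<in>M. \<exists>c. (\<forall>s\<in>S. c s \<in> R) \<and> x = (\<Sum>s\<in>S. act s (c s))))"

definition stably_free_module ::
  "'r::ring_1 set \<Rightarrow> 'm::ab_group_add set \<Rightarrow> ('m \<Rightarrow> 'r \<Rightarrow> 'm) \<Rightarrow> bool" where
  "stably_free_module R M act \<longleftrightarrow>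
     finitely_generated_module R M act \<and>
     (\<exists>n m. module_iso R (M \<times> free_pow R n) (sum_act act pow_act) (free_pow R m) pow_act)"

locale assoc_algebra = vector_space scale
  for scale :: "'k::field \<Rightarrow> 'b::ring_1 \<Rightarrow> 'b" +
  assumes scale_mult_left: "scale c x * y = scale c (x * y)"
    and scale_mult_right: "x * scale c y = scale c (x * y)"

definition is_subalgebra :: "('k::field \<Rightarrow> 'b::ring_1 \<Rightarrow> 'b) \<Rightarrow> 'b set \<Rightarrow> bool" where
  "is_subalgebra scale S \<longleftrightarrow> is_subring S \<and> (\<forall>c. \<forall>x\<in>S. scale c x \<in> S)"

definition derivation_on ::
  "('k::field \<Rightarrow> 'b::ring_1 \<Rightarrow> 'b) \<Rightarrow> 'b set \<Rightarrow> ('b \<Rightarrow> 'b) \<Rightarrow> bool" where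
  "derivation_on scale A d \<longleftrightarrow>
     (\<forall>x\<in>A. d x \<in> A) \<and>
     (\<forall>x\<in>A. \<forall>y\<in>A. d (x + y) = d x + d y) \<and>
     (\<forall>c. \<forall>x\<in>A. d (scale c x) = scale c (d x)) \<and>
     (\<forall>x\<in>A. \<forall>y\<in>A. d (x * y) = d x * y + x * d y)"

locale lie_algebra = vector_space scale
  for scale :: "'k::field \<Rightarrow> 'g::ab_group_add \<Rightarrow> 'g" +
  fixes bracket :: "'g \<Rightarrow> 'g \<Rightarrow> 'g"
  assumes bracket_linear_left: "Vector_Spaces.linear scale scale (\<lambda>x. bracket x y)"
    and bracket_linear_right: "Vector_Spaces.linear scale scale (\<lambda>y. bracket x y)"
    and bracket_self: "bracket x x = 0"
    and jacobi: "bracket x (bracket y z) + bracket y (bracket z x) + bracket z (bracket x y) = 0"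

(* The exponent vector of an ordered monomial is the multiset of indices in which i occurs j_i
   times; listing it in increasing order gives g_1^{j_1} ... g_m^{j_m} with increasing indices. *)
definition ordered_monomial :: "('i::linorder \<Rightarrow> 'b::ring_1) \<Rightarrow> 'i multiset \<Rightarrow> 'b" where
  "ordered_monomial x j = prod_list (map x (sorted_list_of_multiset j))"

(* UNIV :: 'b set is a crossed product of A with the enveloping algebra of the Lie algebra 'g
   having the ordered basis e i, i in I; the map g \<mapsto> bar g is the embedding. *)
locale crossed_product =
  B: assoc_algebra scaleB + G: lie_algebra scaleG bracket
  for scaleB :: "'k::field \<Rightarrow> 'b::ring_1 \<Rightarrow> 'b"
    and scaleG :: "'k \<Rightarrow> 'g::ab_group_add \<Rightarrow> 'g"
    and bracket :: "'g \<Rightarrow> 'g \<Rightarrow> 'g" +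
  fixes A :: "'b set"
    and I :: "'i::linorder set"
    and e :: "'i \<Rightarrow> 'g"
    and bar :: "'g \<Rightarrow> 'b"
  assumes subalgebra: "is_subalgebra scaleB A"
    and basis_inj: "inj_on e I"
    and basis_independent: "G.independent (e ` I)"
    and basis_span: "G.span (e ` I) = UNIV"
    and bar_linear: "Vector_Spaces.linear scaleG scaleB bar"
    and bar_inj: "inj bar"
    and bar_derivation: "derivation_on scaleB A (\<lambda>a. bar g * a - a * bar g)"
    and bar_bracket: "(bar g * bar h - bar h * bar g) - bar (bracket g h) \<in> A"
    and monomial_basis:
      "right_module_basis A UNIV (*) {j. set_mset j \<subseteq> I} (ordered_monomial (\<lambda>i. bar (e i)))"

(* The subalgebra of B generated by A and x; for x = bar g this is A[g, \<delta>]. *)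
definition adjoin :: "('k::field \<Rightarrow> 'b::ring_1 \<Rightarrow> 'b) \<Rightarrow> 'b set \<Rightarrow> 'b \<Rightarrow> 'b set" where
  "adjoin scale A x = is_subalgebra scale hull (insert x A)"

definition unimodular_row2 :: "'r::ring_1 set \<Rightarrow> 'r \<Rightarrow> 'r \<Rightarrow> bool" where
  "unimodular_row2 R x y \<longleftrightarrow> x \<in> R \<and> y \<in> R \<and> {x * a + y * b | a b. a \<in> R \<and> b \<in> R} = R"

end

theory Submission
  imports Defs "HOL-Library.Multiset_Order"
begin

text \<open>
  Write \<open>s = bar g + q\<close> and \<open>r u + s v = 1\<close>, and let \<open>P = rB \<inter> sB\<close>.

  Stable freeness. The crossed product \<open>B\<close> is a domain, so the kernel of the surjection
  \<open>B\<^sup>2 \<rightarrow> B\<close>, \<open>(a, b) \<mapsto> r a + s b\<close>, is a copy of \<open>P\<close>, and the section \<open>1 \<mapsto> (u, v)\<close> gives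
  \<open>P \<oplus> B \<cong> B\<^sup>2\<close> (\<open>intersection_of_unimodular_row\<close>). A basis of a free \<open>P\<close> would therefore be
  finite and, by invariance of the basis number, have one element
  (\<open>free_complement_of_rank_one_is_cyclic\<close>). What is left is to show that \<open>P\<close> is not principal.

  The filtration. Let the degree of an element be the largest size of an ordered monomial in it.
  Reordering a word in the generators, or moving an element of \<open>A\<close> past it, costs only terms of
  lower degree. Hence the top-degree coefficients of a product are those of the product in the
  polynomial ring over \<open>A\<close> with central variables indexed by \<open>I\<close>, which is the associated graded
  ring (\<open>coef_mult_top\<close>). Choosing the largest top-degree monomial for an order compatible with
  multiplication shows that \<open>B\<close> is a domain in which degrees add (\<open>mult_leading_monomials\<close>).

  Non-principality. Suppose \<open>P = f B\<close>. Then \<open>f = s b = r a\<close> for some \<open>a, b\<close>. As \<open>A\<close> is a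
  noetherian domain, there are \<open>t \<noteq> 0\<close> and \<open>w\<close> in \<open>A\<close> with
  \<open>(bar g r - r bar g + q r) t = r w\<close> (\<open>right_Ore\<close>), so
  \<open>s (r t) = r (bar g t + w)\<close> lies in \<open>P = s b B\<close>. Then \<open>r t = b z\<close> has degree \<open>0\<close>, which forces
  \<open>b \<in> A\<close>, and comparing coefficients of degree one in \<open>s b = r a\<close> gives \<open>b \<in> r A\<close>.
  Now \<open>s (1 - v s) = r u s\<close> is in \<open>P\<close>, so \<open>1 - v s\<close> is in \<open>b B\<close> and hence in \<open>r B\<close>: modulo \<open>r B\<close>,
  right multiplication by \<open>s\<close> takes \<open>v\<close> to \<open>1\<close>. This is impossible
  (\<open>no_left_inverse_modulo\<close>): multiplication by \<open>s\<close> raises degrees modulo \<open>r B\<close> by one, while \<open>1\<close>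
  has degree \<open>0\<close> and is nonzero there, \<open>r\<close> being a non-unit.
\<close>

section \<open>Coefficients with respect to the ordered monomials\<close>

lemma finite_submultisets: "finite {j. j \<subseteq># (l :: 'a multiset)}"
proof (induction l)
  case (add i l)
  have "{j. j \<subseteq># add_mset i l} \<subseteq> {j. j \<subseteq># l} \<union> add_mset i ` {j. j \<subseteq># l}"
  proof
    fix j assume j: "j \<in> {j. j \<subseteq># add_mset i l}"
    show "j \<in> {j. j \<subseteq># l} \<union> add_mset i ` {j. j \<subseteq># l}"
    proof (cases "i \<in># j")
      case True
      then obtain j' where j': "j = add_mset i j'" using multi_member_split[of i j] by blast
      have "add_mset i j' \<subseteq># add_mset i l" using j unfolding j' by blast
      hence "j' \<subseteq># l" by (rule mset_subset_eq_add_mset_cancel[THEN iffD1])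
      thus ?thesis unfolding j' by blast
    next
      case False
      hence "j \<subseteq># l"
        using j minus_add_mset_if_not_in_lhs[of i j l]
        by (simp flip: Diff_eq_empty_iff_mset)
      thus ?thesis by simp
    qed
  qed
  thus ?case using add finite_subset by blast
qed simp

context crossed_product
begin

abbreviation exponents :: "'i multiset set" where
  "exponents \<equiv> {j. set_mset j \<subseteq> I}"

abbreviation monomial :: "'i multiset \<Rightarrow> 'b" where
  "monomial \<equiv> ordered_monomial (\<lambda>i. bar (e i))"

definition coef :: "'b \<Rightarrow> 'i multiset \<Rightarrow> 'b" where
  "coef x = (THE c. (\<forall>j\<in>exponents. c j \<in> A) \<and> (\<forall>j. j \<notin> exponents \<longrightarrow> c j = 0) \<and>
     finite {j. c j \<noteq> 0} \<and> x = (\<Sum>j | c j \<noteq> 0. monomial j * c j))"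

lemma A_closed [simp, intro]:
  "0 \<in> A" "1 \<in> A" "a \<in> A \<Longrightarrow> b \<in> A \<Longrightarrow> a + b \<in> A" "a \<in> A \<Longrightarrow> b \<in> A \<Longrightarrow> a - b \<in> A"
  "a \<in> A \<Longrightarrow> b \<in> A \<Longrightarrow> a * b \<in> A" "a \<in> A \<Longrightarrow> - a \<in> A"
proof -
  have 1: "1 \<in> A" and d: "\<And>x y. x \<in> A \<Longrightarrow> y \<in> A \<Longrightarrow> x - y \<in> A"
    and m: "\<And>x y. x \<in> A \<Longrightarrow> y \<in> A \<Longrightarrow> x * y \<in> A"
    using subalgebra unfolding is_subalgebra_def is_subring_def by auto
  have 0: "0 \<in> A" using d[OF 1 1] by simp
  have n: "- x \<in> A" if "x \<in> A" for x using d[OF 0 that] by simp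
  show "0 \<in> A" "1 \<in> A" "a \<in> A \<Longrightarrow> b \<in> A \<Longrightarrow> a - b \<in> A" "a \<in> A \<Longrightarrow> b \<in> A \<Longrightarrow> a * b \<in> A"
    "a \<in> A \<Longrightarrow> - a \<in> A" by (fact 0 1 d m n)+
  show "a \<in> A \<Longrightarrow> b \<in> A \<Longrightarrow> a + b \<in> A" using d[of a "- b"] n[of b] by simp
qed

lemma scale_in_A [simp, intro]: "a \<in> A \<Longrightarrow> scaleB c a \<in> A"
  using subalgebra unfolding is_subalgebra_def by auto

text \<open>Scalars act as multiplication by central elements of \<open>A\<close>. This turns
  \<open>k\<close>-linear statements into statements about right \<open>A\<close>-coefficients.\<close>
lemma scale_eq_mult: "scaleB c x = x * scaleB c 1" "scaleB c x = scaleB c 1 * x"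
  by (simp_all add: B.scale_mult_right B.scale_mult_left)

lemma bar_commutator_in_A [simp, intro]: "a \<in> A \<Longrightarrow> bar h * a - a * bar h \<in> A"
  using bar_derivation[of h] unfolding derivation_on_def by blast

lemma coefs_exist_unique:
  "\<exists>!c. (\<forall>j\<in>exponents. c j \<in> A) \<and> (\<forall>j. j \<notin> exponents \<longrightarrow> c j = 0) \<and>
     finite {j. c j \<noteq> 0} \<and> x = (\<Sum>j | c j \<noteq> 0. monomial j * c j)"
  by (rule bspec[OF conjunct2[OF monomial_basis[unfolded right_module_basis_def]] UNIV_I])

lemma coef_spec:
  "(\<forall>j\<in>exponents. coef x j \<in> A) \<and> (\<forall>j. j \<notin> exponents \<longrightarrow> coef x j = 0) \<and>
   finite {j. coef x j \<noteq> 0} \<and> x = (\<Sum>j | coef x j \<noteq> 0. monomial j * coef x j)"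
  unfolding coef_def by (rule theI'[OF coefs_exist_unique])

lemma coef_in_A [simp, intro]: "coef x j \<in> A"
  using coef_spec[of x] by (cases "j \<in> exponents") auto

lemma coef_outside: "coef x j \<noteq> 0 \<Longrightarrow> set_mset j \<subseteq> I"
  using coef_spec[of x] by auto

lemma finite_coef [simp, intro]: "finite {j. coef x j \<noteq> 0}"
  using coef_spec[of x] by auto

lemma coef_expansion:
  assumes "finite T" "{j. coef x j \<noteq> 0} \<subseteq> T"
  shows "x = (\<Sum>j\<in>T. monomial j * coef x j)"
proof -
  have "x = (\<Sum>j | coef x j \<noteq> 0. monomial j * coef x j)"
    using coef_spec[of x] by (elim conjE)
  also have "\<dots> = (\<Sum>j\<in>T. monomial j * coef x j)"
    by (rule sum.mono_neutral_left) (use assms in auto)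
  finally show ?thesis .
qed

lemma coef_unique:
  assumes "finite T" "\<And>j. c j \<noteq> 0 \<Longrightarrow> j \<in> T" "\<And>j. c j \<noteq> 0 \<Longrightarrow> set_mset j \<subseteq> I"
    "\<And>j. c j \<in> A" "x = (\<Sum>j\<in>T. monomial j * c j)"
  shows "coef x = c"
proof -
  have fin: "finite {j. c j \<noteq> 0}"
    by (rule finite_subset[OF _ assms(1)]) (use assms(2) in auto)
  have "x = (\<Sum>j | c j \<noteq> 0. monomial j * c j)"
    unfolding assms(5) by (rule sum.mono_neutral_right) (use assms in auto)
  with fin assms show ?thesis
    unfolding coef_def by (intro the1_equality coefs_exist_unique) auto
qed

lemma coef_add [simp]: "coef (x + y) j = coef x j + coef y j"
proof -
  let ?T = "{j. coef x j \<noteq> 0} \<union> {j. coef y j \<noteq> 0}"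
  have "coef (x + y) = (\<lambda>j. coef x j + coef y j)"
  proof (rule coef_unique[of ?T])
    show "x + y = (\<Sum>j\<in>?T. monomial j * (coef x j + coef y j))"
      using coef_expansion[of ?T x] coef_expansion[of ?T y]
      by (simp add: distrib_left sum.distrib)
    show "set_mset j \<subseteq> I" if "coef x j + coef y j \<noteq> 0" for j
      using that coef_outside[of x j] coef_outside[of y j] by force
  qed auto
  thus ?thesis by simp
qed

lemma coef_mult_right:
  assumes "a \<in> A" shows "coef (x * a) j = coef x j * a"
proof -
  have "coef (x * a) = (\<lambda>j. coef x j * a)"
  proof (rule coef_unique[of "{j. coef x j \<noteq> 0}"])
    show "x * a = (\<Sum>j | coef x j \<noteq> 0. monomial j * (coef x j * a))"
      by (subst coef_expansion[OF finite_coef order_refl, of x])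
        (simp add: sum_distrib_right mult.assoc)
    show "set_mset j \<subseteq> I" if "coef x j * a \<noteq> 0" for j
      using that coef_outside[of x j] by force
  qed (use assms in auto)
  thus ?thesis by simp
qed

lemma coef_zero [simp]: "coef 0 j = 0"
  using coef_mult_right[of 0 0 j] by simp

lemma coef_uminus [simp]: "coef (- x) j = - coef x j"
  using coef_mult_right[of "- 1" x j] by simp

lemma coef_diff [simp]: "coef (x - y) j = coef x j - coef y j"
  using coef_add[of x "- y" j] by simp

lemma coef_sum: "coef (sum f T) j = (\<Sum>t\<in>T. coef (f t) j)"
  by (induction T rule: infinite_finite_induct) auto

lemma coef_monomial:
  assumes "set_mset j \<subseteq> I" "a \<in> A"
  shows "coef (monomial j * a) k = (if k = j then a else 0)"
proof -
  have "coef (monomial j * a) = (\<lambda>k. if k = j then a else 0)"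
    by (rule coef_unique[of "{j}"]) (use assms in \<open>auto split: if_splits\<close>)
  thus ?thesis by simp
qed

lemma coef_eq_zero_iff: "(\<forall>j. coef x j = 0) \<longleftrightarrow> x = 0"
  using coef_expansion[of "{}" x] by auto

lemma monomial_empty [simp]: "monomial {#} = 1"
  by (simp add: ordered_monomial_def)

lemma coef_A: "a \<in> A \<Longrightarrow> coef a k = (if k = {#} then a else 0)"
  using coef_monomial[of "{#}" a k] by simp

lemma in_A_iff: "x \<in> A \<longleftrightarrow> (\<forall>j. coef x j \<noteq> 0 \<longrightarrow> j = {#})"
proof
  assume "\<forall>j. coef x j \<noteq> 0 \<longrightarrow> j = {#}"
  then have "x = coef x {#}" using coef_expansion[of "{{#}}" x] by auto
  thus "x \<in> A" by (metis coef_in_A)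
qed (simp add: coef_A)

section \<open>The degree filtration\<close>

text \<open>A strict bound makes the bottom step \<open>0\<close>, so that "up to lower terms" needs no case
  distinction in degree \<open>0\<close>.\<close>
definition degree_below :: "nat \<Rightarrow> 'b set" where
  "degree_below n = {x. \<forall>j. coef x j \<noteq> 0 \<longrightarrow> size j < n}"

definition word :: "'i list \<Rightarrow> 'b" where
  "word w = prod_list (map (\<lambda>i. bar (e i)) w)"

lemma word_simps [simp]:
  "word [] = 1" "word (i # w) = bar (e i) * word w" "word (v @ w) = word v * word w"
  by (simp_all add: word_def)

lemma monomial_eq_word: "monomial j = word (sorted_list_of_multiset j)"
  by (simp add: ordered_monomial_def word_def)

text \<open>The same filtration described by arbitrary words instead of sorted ones. Its closure
  under products is easy to prove, and \<open>word_span_eq_degree_below\<close> transfers this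
  to \<open>degree_below\<close>.\<close>
inductive_set word_span :: "nat \<Rightarrow> 'b set" for n where
  zero: "0 \<in> word_span n"
| add: "\<lbrakk>set w \<subseteq> I; length w < n; a \<in> A; x \<in> word_span n\<rbrakk> \<Longrightarrow> word w * a + x \<in> word_span n"

lemma word_span_word: "\<lbrakk>set w \<subseteq> I; length w < n; a \<in> A\<rbrakk> \<Longrightarrow> word w * a \<in> word_span n"
  using word_span.add[OF _ _ _ word_span.zero, of w n a] by simp

lemma word_span_add: "x \<in> word_span n \<Longrightarrow> y \<in> word_span n \<Longrightarrow> x + y \<in> word_span n"
  by (induction rule: word_span.induct) (auto simp: add.assoc intro: word_span.add)

lemma word_span_mult_right: "x \<in> word_span n \<Longrightarrow> a \<in> A \<Longrightarrow> x * a \<in> word_span n"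
  by (induction rule: word_span.induct)
    (auto simp: distrib_right mult.assoc intro!: word_span.zero word_span.add)

lemma word_span_uminus: "x \<in> word_span n \<Longrightarrow> - x \<in> word_span n"
  using word_span_mult_right[of x n "- 1"] by simp

lemma word_span_diff: "x \<in> word_span n \<Longrightarrow> y \<in> word_span n \<Longrightarrow> x - y \<in> word_span n"
  using word_span_add[of x n "- y"] word_span_uminus[of y n] by simp

lemma word_span_mono: "x \<in> word_span m \<Longrightarrow> m \<le> n \<Longrightarrow> x \<in> word_span n"
  by (induction rule: word_span.induct) (auto intro: word_span.intros)

lemma word_span_sum: "(\<And>t. t \<in> T \<Longrightarrow> f t \<in> word_span n) \<Longrightarrow> sum f T \<in> word_span n"
  by (induction T rule: infinite_finite_induct) (auto intro: word_span.zero word_span_add)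

lemma word_span_word_mult:
  assumes "set v \<subseteq> I" "x \<in> word_span n"
  shows "word v * x \<in> word_span (length v + n)"
  using assms(2)
proof (induction rule: word_span.induct)
  case (add w a x)
  have "word (v @ w) * a + word v * x \<in> word_span (length v + n)"
    by (rule word_span.add) (use add assms in auto)
  thus ?case by (simp add: distrib_left mult.assoc)
qed (simp add: word_span.zero)

text \<open>Moving \<open>a\<close> past the first letter leaves the element \<open>bar (e i) * a - a * bar (e i)\<close> of \<open>A\<close>
  in place of that letter, which shortens the word.\<close>
lemma word_commutes_up_to_lower:
  assumes "set w \<subseteq> I" "a \<in> A"
  shows "a * word w - word w * a \<in> word_span (length w)"
  using assms
proof (induction w arbitrary: a)
  case (Cons i w)
  let ?y = "bar (e i)" and ?d = "bar (e i) * a - a * bar (e i)"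
  have d: "?d \<in> A" using Cons.prems by auto
  have 1: "word [i] * (a * word w - word w * a) \<in> word_span (length [i] + length w)"
    by (rule word_span_word_mult) (use Cons in auto)
  have "(?d * word w - word w * ?d) + word w * ?d \<in> word_span (length (i # w))"
    by (intro word_span_add word_span_mono[OF Cons.IH] word_span_word) (use Cons.prems d in auto)
  hence 2: "?d * word w \<in> word_span (length (i # w))" by simp
  have "a * word (i # w) - word (i # w) * a = word [i] * (a * word w - word w * a) - ?d * word w"
    by (simp add: algebra_simps)
  thus ?case using word_span_diff[OF _ 2] 1 by simp
qed (simp add: word_span.zero)

lemma word_span_mult_left:
  assumes "a \<in> A" "x \<in> word_span n" shows "a * x \<in> word_span n"
  using assms(2)
proof (induction rule: word_span.induct)
  case (add w b x)
  have "(a * word w - word w * a) * b + word w * (a * b) + a * x \<in> word_span n"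
    by (rule word_span_add[OF word_span_add[OF word_span_mult_right[OF
              word_span_mono[OF word_commutes_up_to_lower]] word_span_word]])
      (use add assms in auto)
  thus ?case by (simp add: algebra_simps)
qed (simp add: word_span.zero)

lemma word_span_mult:
  assumes "x \<in> word_span (Suc m)" "y \<in> word_span n" shows "x * y \<in> word_span (m + n)"
  using assms(1)
proof (induction rule: word_span.induct)
  case (add w a x)
  have "word w * (a * y) + x * y \<in> word_span (m + n)"
    by (rule word_span_add[OF word_span_mono[OF word_span_word_mult[OF _ word_span_mult_left]]])
      (use add assms in auto)
  thus ?case by (simp add: algebra_simps)
qed (simp add: word_span.zero)

lemma bar_induct:
  assumes "P 0" "\<And>x y. P x \<Longrightarrow> P y \<Longrightarrow> P (x + y)" "\<And>c x. P x \<Longrightarrow> P (scaleB c x)"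
    "\<And>i. i \<in> I \<Longrightarrow> P (bar (e i))"
  shows "P (bar h)"
proof -
  interpret bar: Vector_Spaces.linear scaleG scaleB bar by (fact bar_linear)
  have "h \<in> G.span (e ` I)" using basis_span by simp
  thus ?thesis
  proof (induction rule: G.span_induct)
    case base
    show ?case
      unfolding G.subspace_def using assms by (auto simp: bar.zero bar.add bar.scale)
  next
    case (step x)
    thus ?case using assms(4) by auto
  qed
qed

lemma bar_in_word_span: "bar h \<in> word_span (Suc (Suc 0))"
proof (rule bar_induct)
  show "bar (e i) \<in> word_span (Suc (Suc 0))" if "i \<in> I" for i
    using word_span_word[of "[i]" "Suc (Suc 0)" 1] that by simp
  show "scaleB c x \<in> word_span (Suc (Suc 0))" if "x \<in> word_span (Suc (Suc 0))" for c x
    using word_span_mult_right[OF that, of "scaleB c 1"] scale_eq_mult(1)[of c x] by simp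
qed (auto intro: word_span.zero word_span_add)

lemma bar_commutator_in_word_span: "bar h * bar k - bar k * bar h \<in> word_span (Suc (Suc 0))"
proof -
  let ?a = "(bar h * bar k - bar k * bar h) - bar (bracket h k)"
  have "word [] * ?a + bar (bracket h k) \<in> word_span (Suc (Suc 0))"
    by (rule word_span_add[OF word_span_word bar_in_word_span]) (use bar_bracket in auto)
  thus ?thesis by simp
qed

text \<open>Exchanging adjacent letters costs a commutator, which has degree at most one by
  \<open>bar_bracket\<close>: two letters are replaced by at most one.\<close>
lemma word_insort:
  assumes "i \<in> I" "set w \<subseteq> I"
  shows "word (i # w) - word (insort i w) \<in> word_span (Suc (length w))"
  using assms(2)
proof (induction w)
  case (Cons j w)
  show ?case
  proof (cases "i \<le> j")
    case False
    let ?c = "bar (e i) * bar (e j) - bar (e j) * bar (e i)"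
    have "word w * 1 \<in> word_span (Suc (length w))"
      by (rule word_span_word) (use Cons.prems in auto)
    hence 1: "?c * word w \<in> word_span (Suc 0 + Suc (length w))"
      by (intro word_span_mult bar_commutator_in_word_span) simp
    have 2: "word [j] * (word (i # w) - word (insort i w)) \<in> word_span (length [j] + Suc (length w))"
      by (rule word_span_word_mult) (use Cons in auto)
    have "word (i # j # w) - word (insort i (j # w)) =
        ?c * word w + word [j] * (word (i # w) - word (insort i w))"
      using False by (simp add: algebra_simps)
    thus ?thesis using word_span_add 1 2 by auto
  qed (simp add: word_span.zero)
qed (simp add: word_span.zero)

text \<open>Insertion sort on the letters of the word.\<close>
lemma word_eq_monomial_up_to_lower:
  assumes "set w \<subseteq> I"
  shows "word w - monomial (mset w) \<in> word_span (length w)"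
  using assms
proof (induction w)
  case (Cons i w)
  let ?s = "sorted_list_of_multiset (mset w)"
  have s: "set ?s \<subseteq> I" "length ?s = length w"
    using Cons.prems by (auto simp flip: size_mset)
  have 1: "word [i] * (word w - monomial (mset w)) \<in> word_span (length [i] + length w)"
    by (rule word_span_word_mult) (use Cons in auto)
  have 2: "word (i # ?s) - word (insort i ?s) \<in> word_span (Suc (length ?s))"
    by (rule word_insort) (use Cons.prems s in auto)
  have "word (i # w) - monomial (mset (i # w)) =
      word [i] * (word w - monomial (mset w)) + (word (i # ?s) - word (insort i ?s))"
    by (simp add: monomial_eq_word algebra_simps)
  thus ?case using word_span_add 1 2 s by auto
qed (simp add: word_span.zero)

lemma degree_below_zero [simp]: "0 \<in> degree_below n"
  by (simp add: degree_below_def)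

lemma degree_below_add: "x \<in> degree_below n \<Longrightarrow> y \<in> degree_below n \<Longrightarrow> x + y \<in> degree_below n"
  unfolding degree_below_def by (simp, metis add.right_neutral)

lemma degree_below_monomial:
  "set_mset j \<subseteq> I \<Longrightarrow> a \<in> A \<Longrightarrow> size j < n \<Longrightarrow> monomial j * a \<in> degree_below n"
  unfolding degree_below_def by (auto simp: coef_monomial split: if_splits)

lemma degree_below_mult_right: "x \<in> degree_below n \<Longrightarrow> a \<in> A \<Longrightarrow> x * a \<in> degree_below n"
  unfolding degree_below_def by (force simp: coef_mult_right)

lemma degree_below_mono: "x \<in> degree_below m \<Longrightarrow> m \<le> n \<Longrightarrow> x \<in> degree_below n"
  unfolding degree_below_def by force

lemma degree_below_one: "x \<in> degree_below 1 \<longleftrightarrow> x \<in> A"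
  by (auto simp: in_A_iff degree_below_def)

text \<open>The straightening part of the Poincare-Birkhoff-Witt theorem: sorting a word costs only
  shorter words, which are handled by induction on the length.\<close>
lemma word_span_eq_degree_below: "word_span n = degree_below n"
proof
  show "degree_below n \<subseteq> word_span n"
  proof
    fix x assume x: "x \<in> degree_below n"
    have "(\<Sum>j | coef x j \<noteq> 0. monomial j * coef x j) \<in> word_span n"
    proof (rule word_span_sum)
      fix j assume j: "j \<in> {j. coef x j \<noteq> 0}"
      show "monomial j * coef x j \<in> word_span n"
        unfolding monomial_eq_word using j x coef_outside[of x j]
        by (intro word_span_word) (auto simp: degree_below_def simp flip: size_mset)
    qed
    thus "x \<in> word_span n" using coef_expansion[of "{j. coef x j \<noteq> 0}" x] by simp
  qed
  show "word_span n \<subseteq> degree_below n"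
  proof (induction n rule: less_induct)
    case (less n)
    show ?case
    proof
      fix x assume "x \<in> word_span n"
      thus "x \<in> degree_below n"
      proof (induction rule: word_span.induct)
        case (add w a x)
        have "word w - monomial (mset w) \<in> degree_below n"
          using word_eq_monomial_up_to_lower[of w] less[of "length w"] add
          by (auto intro: degree_below_mono)
        hence "(word w - monomial (mset w)) * a + monomial (mset w) * a + x \<in> degree_below n"
          using add by (intro degree_below_add degree_below_mult_right degree_below_monomial) auto
        thus ?case by (simp add: algebra_simps)
      qed simp
    qed
  qed
qed

section \<open>Leading coefficients of products\<close>

lemma coef_monomial_mult:
  assumes "set_mset j \<subseteq> I" "set_mset k \<subseteq> I" "a \<in> A" "b \<in> A" "size j + size k \<le> size l"
  shows "coef ((monomial j * a) * (monomial k * b)) l = (if j + k = l then a * b else 0)"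
proof -
  let ?u = "sorted_list_of_multiset j" and ?v = "sorted_list_of_multiset k"
  have u: "set ?u \<subseteq> I" "length ?u = size j" "set ?v \<subseteq> I" "length ?v = size k"
    using assms by (auto simp flip: size_mset)
  have 1: "monomial j * (a * monomial k - monomial k * a) \<in> degree_below (size l)"
    using word_span_word_mult[OF u(1) word_commutes_up_to_lower[OF u(3) assms(3)]] assms(5) u
    by (auto simp: monomial_eq_word word_span_eq_degree_below intro: degree_below_mono)
  have 2: "monomial j * monomial k - monomial (j + k) \<in> degree_below (size l)"
    using word_eq_monomial_up_to_lower[of "?u @ ?v"] assms(5) u
    by (auto simp: monomial_eq_word word_span_eq_degree_below intro: degree_below_mono)
  have low: "coef (x * c) l = 0" if "x \<in> degree_below (size l)" "c \<in> A" for x c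
    using degree_below_mult_right[OF that] by (auto simp: degree_below_def)
  have "(monomial j * a) * (monomial k * b) =
      monomial j * (a * monomial k - monomial k * a) * b
      + (monomial j * monomial k - monomial (j + k)) * (a * b) + monomial (j + k) * (a * b)"
    by (simp add: algebra_simps)
  also have "coef \<dots> l = coef (monomial (j + k) * (a * b)) l"
    using low[OF 1, of b] low[OF 2, of "a * b"] assms by simp
  also have "\<dots> = (if j + k = l then a * b else 0)"
    using assms by (subst coef_monomial) auto
  finally show ?thesis .
qed

text \<open>The associated graded ring is the polynomial ring over \<open>A\<close> in central variables indexed
  by \<open>I\<close>. No restriction to \<open>size j = p\<close> is needed on the right: in every other summand one
  of the two coefficients is beyond the degree bound.\<close>
lemma coef_mult_top:
  assumes x: "x \<in> degree_below (Suc p)" and y: "y \<in> degree_below (Suc q)" and l: "size l = p + q"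
  shows "coef (x * y) l = (\<Sum>j | j \<subseteq># l. coef x j * coef y (l - j))"
proof -
  let ?X = "{j. coef x j \<noteq> 0}" and ?Y = "{j. coef y j \<noteq> 0}"
  have "x * y = (\<Sum>j\<in>?X. monomial j * coef x j) * (\<Sum>k\<in>?Y. monomial k * coef y k)"
    using coef_expansion[of ?X x] coef_expansion[of ?Y y] by simp
  also have "\<dots> = (\<Sum>j\<in>?X. \<Sum>k\<in>?Y. (monomial j * coef x j) * (monomial k * coef y k))"
    by (simp add: sum_product)
  finally have xy: "x * y = \<dots>" .
  have "coef (x * y) l = (\<Sum>j\<in>?X. \<Sum>k\<in>?Y. if j + k = l then coef x j * coef y k else 0)"
    unfolding xy coef_sum
  proof (intro sum.cong refl coef_monomial_mult)
    fix j k assume jk: "j \<in> ?X" "k \<in> ?Y"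
    show "set_mset j \<subseteq> I" "set_mset k \<subseteq> I" using jk coef_outside by auto
    show "size j + size k \<le> size l" using jk x y l by (force simp: degree_below_def)
  qed auto
  also have "\<dots> = (\<Sum>j\<in>?X. if j \<subseteq># l then coef x j * coef y (l - j) else 0)"
  proof (rule sum.cong[OF refl])
    fix j
    have iff: "j + k = l \<longleftrightarrow> k = l - j \<and> j \<subseteq># l" for k
    proof
      assume "j + k = l"
      thus "k = l - j \<and> j \<subseteq># l" by (auto simp del: A_closed)
    next
      assume "k = l - j \<and> j \<subseteq># l"
      thus "j + k = l" by (simp add: subset_mset.add_diff_inverse)
    qed
    have "(\<Sum>k\<in>?Y. if j + k = l then coef x j * coef y k else 0)
        = (\<Sum>k\<in>?Y. if k = l - j then (if j \<subseteq># l then coef x j * coef y k else 0) else 0)"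
      by (rule sum.cong[OF refl]) (simp add: iff)
    also have "\<dots> = (if j \<subseteq># l then coef x j * coef y (l - j) else 0)"
      by (subst sum.delta) auto
    finally show "(\<Sum>k\<in>?Y. if j + k = l then coef x j * coef y k else 0)
        = (if j \<subseteq># l then coef x j * coef y (l - j) else 0)" .
  qed
  also have "\<dots> = (\<Sum>j\<in>?X \<inter> {j. j \<subseteq># l}. coef x j * coef y (l - j))"
    by (subst sum.inter_restrict) auto
  also have "\<dots> = (\<Sum>j | j \<subseteq># l. coef x j * coef y (l - j))"
    by (rule sum.mono_neutral_left) (auto simp: finite_submultisets)
  finally show ?thesis .
qed

lemma coef_mult_top_single:
  assumes "x \<in> degree_below (Suc p)" "y \<in> degree_below (Suc q)" "size j = p" "size k = q"
    and others: "\<And>j' k'. j' + k' = j + k \<Longrightarrow> size j' = p \<Longrightarrow> size k' = q \<Longrightarrow> j' \<noteq> j \<Longrightarrow>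
        coef x j' * coef y k' = 0"
  shows "coef (x * y) (j + k) = coef x j * coef y k"
proof -
  have "coef (x * y) (j + k) = (\<Sum>j' | j' \<subseteq># j + k. coef x j' * coef y (j + k - j'))"
    by (rule coef_mult_top) (use assms in auto)
  also have "\<dots> = (\<Sum>j'\<in>{j}. coef x j' * coef y (j + k - j'))"
  proof (rule sum.mono_neutral_right)
    show "\<forall>j'\<in>{j'. j' \<subseteq># j + k} - {j}. coef x j' * coef y (j + k - j') = 0"
    proof
      fix j' assume j': "j' \<in> {j'. j' \<subseteq># j + k} - {j}"
      then have s: "j' + (j + k - j') = j + k" by simp
      then have sz: "size j' + size (j + k - j') = p + q" using assms by (metis size_union)
      show "coef x j' * coef y (j + k - j') = 0"
      proof (cases "size j' = p")
        case True
        thus ?thesis using sz s j' by (intro others) auto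
      next
        case False
        then have "size j' > p \<or> size (j + k - j') > q" using sz by linarith
        hence "coef x j' = 0 \<or> coef y (j + k - j') = 0"
          using assms(1,2) unfolding degree_below_def by force
        thus ?thesis by auto
      qed
    qed
  qed (auto simp: finite_submultisets)
  finally show ?thesis by simp
qed

text \<open>The leading monomial is the largest one, in the multiset order, among those of maximal size.
  Only monomials of maximal size are compared, because only their coefficients
  multiply as in a polynomial ring.\<close>
lemma leading_monomial:
  assumes "x \<noteq> 0"
  obtains j where "coef x j \<noteq> 0" "x \<in> degree_below (Suc (size j))"
    "\<And>j'. coef x j' \<noteq> 0 \<Longrightarrow> size j' = size j \<Longrightarrow> j' \<le> j"
proof -
  let ?X = "{j. coef x j \<noteq> 0}"
  let ?p = "Max (size ` ?X)"
  let ?J = "{j \<in> ?X. size j = ?p}"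
  have ne: "?X \<noteq> {}" using assms coef_eq_zero_iff by auto
  have "?p \<in> size ` ?X" using ne by (intro Max_in) auto
  hence neJ: "?J \<noteq> {}" by auto
  have finJ: "finite ?J" by (rule finite_subset[OF _ finite_coef[of x]]) auto
  have J: "Max ?J \<in> ?J" using finJ neJ by (rule Max_in)
  show ?thesis
  proof (rule that[of "Max ?J"])
    show "coef x (Max ?J) \<noteq> 0" using J by auto
    have "size j \<le> ?p" if "coef x j \<noteq> 0" for j by (rule Max_ge) (use that in auto)
    thus "x \<in> degree_below (Suc (size (Max ?J)))" using J by (auto simp: degree_below_def less_Suc_eq_le)
    show "j' \<le> Max ?J" if "coef x j' \<noteq> 0" "size j' = size (Max ?J)" for j'
      by (rule Max_ge[OF finJ]) (use that J in auto)
  qed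
qed

lemma in_some_degree_below: "\<exists>n. x \<in> degree_below n"
  by (cases "x = 0") (auto elim: leading_monomial)

lemma coef_mult_left_top:
  assumes "r \<in> A" "y \<in> degree_below (Suc n)" "size l = n"
  shows "coef (r * y) l = r * coef y l"
proof -
  have r: "r \<in> degree_below (Suc 0)" using assms(1) degree_below_one by simp
  have "coef (r * y) ({#} + l) = coef r {#} * coef y l"
    by (rule coef_mult_top_single[OF r assms(2)]) (use assms in auto)
  thus ?thesis using assms(1) by (simp add: coef_A)
qed

section \<open>Elements of the Lie algebra and linear factors\<close>

lemma scale_one_mult: "scaleB c 1 * scaleB d 1 = scaleB (c * d) 1"
  by (simp add: B.scale_mult_left)

text \<open>Being homogeneous of degree one with coefficients in the field passes from the basis to its span.
  The coefficients matter because nonzero scalars are units of \<open>A\<close>.\<close>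
lemma coef_bar: "\<exists>c. coef (bar h) j = scaleB c 1 \<and> (c \<noteq> 0 \<longrightarrow> size j = 1)"
proof -
  let ?P = "\<lambda>x. \<forall>j. \<exists>c. coef x j = scaleB c 1 \<and> (c \<noteq> 0 \<longrightarrow> size j = 1)"
  have "?P (bar h)"
  proof (rule bar_induct[of ?P])
    show "?P 0" by (intro allI exI[of _ 0]) simp
  next
    fix x y assume x: "?P x" and y: "?P y"
    show "?P (x + y)"
    proof
      fix j
      obtain c d where "coef x j = scaleB c 1" "c \<noteq> 0 \<longrightarrow> size j = 1"
        "coef y j = scaleB d 1" "d \<noteq> 0 \<longrightarrow> size j = 1" using x y by metis
      thus "\<exists>c. coef (x + y) j = scaleB c 1 \<and> (c \<noteq> 0 \<longrightarrow> size j = 1)"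
        by (intro exI[of _ "c + d"]) (auto simp: B.scale_left_distrib)
    qed
  next
    fix d x assume x: "?P x"
    show "?P (scaleB d x)"
    proof
      fix j
      obtain c where c: "coef x j = scaleB c 1" "c \<noteq> 0 \<longrightarrow> size j = 1" using x by metis
      have "coef (scaleB d x) j = scaleB (c * d) 1"
        by (subst scale_eq_mult(1)) (simp add: coef_mult_right c scale_one_mult)
      thus "\<exists>c. coef (scaleB d x) j = scaleB c 1 \<and> (c \<noteq> 0 \<longrightarrow> size j = 1)"
        using c(2) by (intro exI[of _ "c * d"]) auto
    qed
  next
    fix i assume i: "i \<in> I"
    have "coef (bar (e i)) j = (if j = {#i#} then 1 else 0)" for j
      using coef_monomial[of "{#i#}" 1 j] i by (simp add: monomial_eq_word)
    thus "?P (bar (e i))"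
      by (intro allI, rule_tac x = "if j = {#i#} then 1 else 0" in exI) auto
  qed
  thus ?thesis by blast
qed

lemma bar_leading_scalar:
  assumes "h \<noteq> 0"
  obtains i c where "coef (bar h) {#i#} = scaleB c 1" "c \<noteq> 0"
proof -
  interpret bar: Vector_Spaces.linear scaleG scaleB bar by (fact bar_linear)
  have "bar h \<noteq> 0" using assms bar_inj bar.zero by (metis injD)
  then obtain j where j: "coef (bar h) j \<noteq> 0" using coef_eq_zero_iff by blast
  obtain c where c: "coef (bar h) j = scaleB c 1" "c \<noteq> 0 \<longrightarrow> size j = 1" using coef_bar by blast
  have "c \<noteq> 0" using c(1) j by auto
  then obtain i where "j = {#i#}" using c(2) size_1_singleton_mset by blast
  thus ?thesis using that c \<open>c \<noteq> 0\<close> by blast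
qed

lemma scalar_cancel: "c \<noteq> 0 \<Longrightarrow> a * scaleB c 1 * scaleB (inverse c) 1 = a"
  by (simp add: mult.assoc scale_one_mult)

text \<open>With coefficients in \<open>A / K\<close> for a right ideal \<open>K\<close> of \<open>A\<close>, right multiplication by the
  leading form of \<open>s\<close> is injective, provided that this linear form has a unit coefficient \<open>c\<close> at
  some variable \<open>i\<close>: among the top monomials of \<open>x\<close> with coefficient outside \<open>K\<close> take one, \<open>m\<close>, with
  the largest power of \<open>i\<close>. In the coefficient of the product at \<open>m\<close> times \<open>i\<close>, all
  contributions of degree \<open>n\<close> other than that of \<open>m\<close> come from monomials with a larger power of \<open>i\<close>,
  and so lie in \<open>K\<close>; those of other degrees vanish.\<close>
lemma linear_factor_cancels_modulo_right_ideal: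
  assumes x: "x \<in> degree_below (Suc n)" and s: "s \<in> degree_below (Suc 1)"
    and lead: "coef s {#i#} = scaleB c 1" "c \<noteq> 0"
    and K: "0 \<in> K" "\<And>a b. a \<in> K \<Longrightarrow> b \<in> K \<Longrightarrow> a - b \<in> K" "\<And>a b. a \<in> K \<Longrightarrow> b \<in> A \<Longrightarrow> a * b \<in> K"
    and prod: "\<And>l. size l = Suc n \<Longrightarrow> coef (x * s) l \<in> K"
    and j: "size j = n"
  shows "coef x j \<in> K"
proof (rule ccontr)
  assume jK: "coef x j \<notin> K"
  have K_sum: "sum f T \<in> K" if "\<And>t. t \<in> T \<Longrightarrow> f t \<in> K" for f and T :: "'i multiset set"
  proof -
    have add: "a + b \<in> K" if "a \<in> K" "b \<in> K" for a b using K(2)[OF that(1) K(2)[OF K(1) that(2)]] by simp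
    show ?thesis using that by (induction T rule: infinite_finite_induct) (auto intro: K add)
  qed
  define T where "T = {j. size j = n \<and> coef x j \<notin> K}"
  have "T \<subseteq> {j. coef x j \<noteq> 0}" using K(1) by (auto simp: T_def)
  hence fin: "finite T" using finite_subset finite_coef by blast
  have "T \<noteq> {}" using j jK by (auto simp: T_def)
  hence "Max ((\<lambda>m. count m i) ` T) \<in> (\<lambda>m. count m i) ` T" using fin by (intro Max_in) auto
  then obtain m where m: "m \<in> T" "Max ((\<lambda>m. count m i) ` T) = count m i" by blast
  have max: "count m' i \<le> count m i" if "m' \<in> T" for m'
    unfolding m(2)[symmetric] using fin that by (intro Max_ge) auto
  let ?l = "add_mset i m"
  have size: "size ?l = n + 1" using m(1) by (simp add: T_def)
  let ?S = "{k. k \<subseteq># ?l}"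
  have "coef (x * s) ?l = (\<Sum>k\<in>?S. coef x k * coef s (?l - k))"
    by (rule coef_mult_top[OF x s size])
  also have "\<dots> = coef x m * coef s (?l - m) + (\<Sum>k\<in>?S - {m}. coef x k * coef s (?l - k))"
    by (rule sum.remove) (auto simp: finite_submultisets)
  finally have eq: "coef x m * scaleB c 1 =
      coef (x * s) ?l - (\<Sum>k\<in>?S - {m}. coef x k * coef s (?l - k))"
    using lead(1) by simp
  have "(\<Sum>k\<in>?S - {m}. coef x k * coef s (?l - k)) \<in> K"
  proof (rule K_sum)
    fix k assume k: "k \<in> ?S - {m}"
    show "coef x k * coef s (?l - k) \<in> K"
    proof (cases "size k = n")
      case True
      have "size (?l - k) = 1" using k True size by (simp add: size_Diff_submset)
      then obtain i' where i': "?l - k = {#i'#}" using size_1_singleton_mset by blast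
      hence l: "?l = add_mset i' k" using k by (metis DiffD1 add_mset_add_single mem_Collect_eq subset_mset.diff_add union_commute)
      hence "i' \<noteq> i" using k by auto
      hence "count k i = Suc (count m i)" using arg_cong[OF l, of "\<lambda>l. count l i"] by simp
      hence "k \<notin> T" using max[of k] by auto
      hence "coef x k \<in> K" using True by (simp add: T_def)
      thus ?thesis using K(3) by blast
    next
      case False
      have "size k + size (?l - k) = n + 1"
        using k size by (metis DiffD1 mem_Collect_eq size_union subset_mset.add_diff_inverse)
      then have "size k \<ge> Suc n \<or> size (?l - k) \<ge> 2" using False by linarith
      hence "coef x k = 0 \<or> coef s (?l - k) = 0"
        using x s unfolding degree_below_def by force
      thus ?thesis using K(1) by auto
    qed
  qed
  hence "coef x m * scaleB c 1 \<in> K" unfolding eq using K(2) prod[of ?l] size by simp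
  hence "coef x m * scaleB c 1 * scaleB (inverse c) 1 \<in> K" by (rule K(3)) simp
  thus False using m(1) scalar_cancel[OF lead(2)] by (simp add: T_def)
qed

end

section \<open>Crossed products over a domain\<close>

locale domain_crossed_product = crossed_product scaleB scaleG bracket A I e bar
  for scaleB :: "'k::field \<Rightarrow> 'b::ring_1 \<Rightarrow> 'b"
    and scaleG :: "'k \<Rightarrow> 'g::ab_group_add \<Rightarrow> 'g"
    and bracket and A :: "'b set" and I :: "'i::linorder set" and e bar +
  assumes domain: "domain_on A"
begin

lemma no_zero_divisors_A: "a \<in> A \<Longrightarrow> b \<in> A \<Longrightarrow> a * b = 0 \<Longrightarrow> a = 0 \<or> b = 0"
  using domain unfolding domain_on_def by blast

text \<open>The multiset order is compatible with the product of monomials, so the leading monomials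
  multiply to a monomial that arises in no other way.\<close>
lemma mult_leading_monomials:
  assumes "x \<noteq> 0" "y \<noteq> 0"
  obtains j k where "x \<in> degree_below (Suc (size j))" "y \<in> degree_below (Suc (size k))"
    "coef x j \<noteq> 0" "coef y k \<noteq> 0" "coef (x * y) (j + k) \<noteq> 0"
proof -
  obtain j where j: "coef x j \<noteq> 0" "x \<in> degree_below (Suc (size j))"
    "\<And>j'. coef x j' \<noteq> 0 \<Longrightarrow> size j' = size j \<Longrightarrow> j' \<le> j"
    using leading_monomial[OF assms(1)] by blast
  obtain k where k: "coef y k \<noteq> 0" "y \<in> degree_below (Suc (size k))"
    "\<And>k'. coef y k' \<noteq> 0 \<Longrightarrow> size k' = size k \<Longrightarrow> k' \<le> k"
    using leading_monomial[OF assms(2)] by blast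
  have "coef (x * y) (j + k) = coef x j * coef y k"
  proof (rule coef_mult_top_single)
    fix j' k' assume h: "j' + k' = j + k" "size j' = size j" "size k' = size k" "j' \<noteq> j"
    show "coef x j' * coef y k' = 0"
    proof (rule ccontr)
      assume "coef x j' * coef y k' \<noteq> 0"
      then have "coef x j' \<noteq> 0" "coef y k' \<noteq> 0" by auto
      then have "j' < j" "k' \<le> k" using j(3) k(3) h by (auto simp: order.strict_iff_order)
      then have "j' + k' < j + k" by (rule add_less_le_mono)
      thus False using h by simp
    qed
  qed (use j k in auto)
  also have "\<dots> \<noteq> 0" using no_zero_divisors_A j(1) k(1) by blast
  finally show ?thesis using that j k by blast
qed

lemma no_zero_divisors: "x * y = 0 \<Longrightarrow> x = 0 \<or> y = 0" for x y :: 'b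
  by (metis coef_zero mult_leading_monomials)

lemma left_cancel: "x * y = x * z \<Longrightarrow> x \<noteq> 0 \<Longrightarrow> y = z" for x y z :: 'b
  using no_zero_divisors[of x "y - z"] by (auto simp: algebra_simps)

lemma degree_below_factor:
  assumes "x * y \<in> degree_below n" "x \<noteq> 0"
  shows "y \<in> degree_below n"
proof (cases "y = 0")
  case False
  then obtain j k where jk: "y \<in> degree_below (Suc (size k))" "coef (x * y) (j + k) \<noteq> 0"
    using mult_leading_monomials[OF assms(2)] by metis
  then have "size (j + k) < n" using assms(1) unfolding degree_below_def by blast
  thus ?thesis using degree_below_mono[OF jk(1)] by simp
qed simp

lemma factors_in_A:
  assumes "x * y \<in> A" "x \<noteq> 0" "y \<noteq> 0"
  shows "x \<in> A" "y \<in> A"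
proof -
  obtain j k where jk: "x \<in> degree_below (Suc (size j))" "y \<in> degree_below (Suc (size k))"
    "coef (x * y) (j + k) \<noteq> 0"
    using mult_leading_monomials[OF assms(2,3)] by metis
  have "j + k = {#}" using jk(3) assms(1) in_A_iff by blast
  thus "x \<in> A" "y \<in> A" using jk by (auto simp flip: degree_below_one)
qed

lemma right_unit_in_A:
  assumes "r \<in> A" "r * x = 1"
  shows "unit_in A r"
proof -
  have r: "r \<noteq> 0" using assms(2) by auto
  have x: "x \<in> A" using factors_in_A(2)[of r x] assms r by auto
  have "r * (x * r) = r * 1" using assms(2) by (metis mult.assoc mult_1_left mult_1_right)
  hence "x * r = 1" using left_cancel r by blast
  thus ?thesis unfolding unit_in_def using assms x by blast
qed

end

section \<open>Finite bases and rank\<close>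

context right_module
begin

lemma ring_closed: "0 \<in> R" "1 \<in> R" "a \<in> R \<Longrightarrow> b \<in> R \<Longrightarrow> a + b \<in> R" "a \<in> R \<Longrightarrow> b \<in> R \<Longrightarrow> a * b \<in> R"
proof -
  have d: "x - y \<in> R" if "x \<in> R" "y \<in> R" for x y
    using that subring unfolding is_subring_def by blast
  show 1: "1 \<in> R" using subring unfolding is_subring_def by blast
  show 0: "0 \<in> R" using d[OF 1 1] by simp
  show "a \<in> R \<Longrightarrow> b \<in> R \<Longrightarrow> a + b \<in> R" using d[of a "0 - b"] d[OF 0, of b] by simp
  show "a \<in> R \<Longrightarrow> b \<in> R \<Longrightarrow> a * b \<in> R" using subring unfolding is_subring_def by blast
qed

lemma add_closed: "x \<in> M \<Longrightarrow> y \<in> M \<Longrightarrow> x + y \<in> M"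
  using diff_closed[of x "0 - y"] diff_closed[OF zero_closed, of y] by simp

lemma sum_closed: "(\<And>t. t \<in> T \<Longrightarrow> f t \<in> M) \<Longrightarrow> sum f T \<in> M"
  by (induction T rule: infinite_finite_induct) (auto intro: zero_closed add_closed)

lemma ring_sum_closed: "(\<And>t. t \<in> T \<Longrightarrow> f t \<in> R) \<Longrightarrow> sum f T \<in> R"
  by (induction T rule: infinite_finite_induct) (auto intro: ring_closed)

lemma act_zero_right: "x \<in> M \<Longrightarrow> act x 0 = 0"
  using act_add_right[of x 0 0] ring_closed by simp

lemma act_zero_left: "a \<in> R \<Longrightarrow> act 0 a = 0"
  using act_add_left[of 0 0 a] zero_closed by simp

lemma act_sum_left:
  "(\<And>t. t \<in> T \<Longrightarrow> f t \<in> M) \<Longrightarrow> a \<in> R \<Longrightarrow> act (sum f T) a = (\<Sum>t\<in>T. act (f t) a)"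
  by (induction T rule: infinite_finite_induct) (auto simp: act_zero_left act_add_left sum_closed)

lemma act_sum_right:
  "x \<in> M \<Longrightarrow> (\<And>t. t \<in> T \<Longrightarrow> f t \<in> R) \<Longrightarrow> act x (sum f T) = (\<Sum>t\<in>T. act x (f t))"
  by (induction T rule: infinite_finite_induct)
    (auto simp: act_zero_right act_add_right ring_sum_closed)

lemma basis_exists:
  assumes "right_module_basis R M act X (\<lambda>x. x)" "x \<in> M"
  obtains c where "finite {j. c j \<noteq> 0}" "{j. c j \<noteq> 0} \<subseteq> X" "\<forall>j. c j \<in> R"
    "x = (\<Sum>j | c j \<noteq> 0. act j (c j))"
proof -
  obtain c where c: "\<forall>j\<in>X. c j \<in> R" "\<forall>j. j \<notin> X \<longrightarrow> c j = 0" "finite {j. c j \<noteq> 0}"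
    "x = (\<Sum>j | c j \<noteq> 0. act j (c j))"
    using ex1_implies_ex[OF bspec[OF conjunct2[OF assms(1)[unfolded right_module_basis_def]] assms(2)]]
    by (elim exE conjE)
  have "c j \<in> R" for j using c(1,2) ring_closed by (cases "j \<in> X") auto
  moreover have "{j. c j \<noteq> 0} \<subseteq> X" using c(2) by auto
  ultimately show ?thesis using that c(3,4) by blast
qed

lemma sum_support_mono:
  assumes "finite T" "{j. c j \<noteq> 0} \<subseteq> T" "T \<subseteq> M"
  shows "(\<Sum>j | c j \<noteq> 0. act j (c j)) = (\<Sum>j\<in>T. act j (c j))"
  by (rule sum.mono_neutral_left) (use assms in \<open>auto intro: act_zero_right\<close>)

lemma basis_unique:
  assumes "right_module_basis R M act X (\<lambda>x. x)" "finite T" "T \<subseteq> X"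
    "\<And>j. j \<in> T \<Longrightarrow> c j \<in> R" "\<And>j. j \<in> T \<Longrightarrow> d j \<in> R"
    "(\<Sum>j\<in>T. act j (c j)) = (\<Sum>j\<in>T. act j (d j))" "j \<in> T"
  shows "c j = d j"
proof -
  have XM: "X \<subseteq> M" using assms(1) unfolding right_module_basis_def by simp
  define ext where "ext b j = (if j \<in> T then b j else (0::'r))" for b j
  define x where "x = (\<Sum>j\<in>T. act j (c j))"
  have x: "x \<in> M" unfolding x_def
    by (intro sum_closed act_closed) (use assms XM in auto)
  have P: "(\<forall>j\<in>X. ext b j \<in> R) \<and> (\<forall>j. j \<notin> X \<longrightarrow> ext b j = 0) \<and> finite {j. ext b j \<noteq> 0} \<and>
      x = (\<Sum>j | ext b j \<noteq> 0. act j (ext b j))"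
    if b: "\<And>j. j \<in> T \<Longrightarrow> b j \<in> R" "x = (\<Sum>j\<in>T. act j (b j))" for b
  proof (intro conjI)
    show "\<forall>j\<in>X. ext b j \<in> R" using b ring_closed by (simp add: ext_def)
    show "\<forall>j. j \<notin> X \<longrightarrow> ext b j = 0" using assms(3) by (auto simp: ext_def)
    show fin: "finite {j. ext b j \<noteq> 0}"
      by (rule finite_subset[OF _ assms(2)]) (auto simp: ext_def split: if_splits)
    have "x = (\<Sum>j\<in>T. act j (ext b j))" using b(2) by (simp add: ext_def)
    also have "\<dots> = (\<Sum>j | ext b j \<noteq> 0. act j (ext b j))"
      by (rule sum.mono_neutral_right)
        (use assms XM in \<open>auto simp: ext_def act_zero_right split: if_splits\<close>)
    finally show "x = (\<Sum>j | ext b j \<noteq> 0. act j (ext b j))" .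
  qed
  have unique: "\<exists>!u. Q u \<Longrightarrow> Q u \<Longrightarrow> Q v \<Longrightarrow> u = v" for Q and u v :: "'m \<Rightarrow> 'r"
    by blast
  have "ext c = ext d"
    by (rule unique[OF bspec[OF conjunct2[OF assms(1)[unfolded right_module_basis_def]] x] P P])
      (use assms in \<open>simp_all add: x_def\<close>)
  from fun_cong[OF this, of j] show ?thesis using assms(7) by (simp add: ext_def)
qed

text \<open>Finitely many generators involve only finitely many basis elements, and a further basis
  element would be a combination of those.\<close>
lemma finite_basis:
  assumes fg: "finitely_generated_module R M act" and X: "right_module_basis R M act X (\<lambda>x. x)"
  shows "finite X"
proof -
  have XM: "X \<subseteq> M" using X unfolding right_module_basis_def by simp
  obtain S where S: "finite S" "S \<subseteq> M"
    "\<And>x. x \<in> M \<Longrightarrow> \<exists>c. (\<forall>s\<in>S. c s \<in> R) \<and> x = (\<Sum>s\<in>S. act s (c s))"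
    using fg unfolding finitely_generated_module_def by blast
  have "\<forall>s\<in>S. \<exists>c. finite {j. c j \<noteq> 0} \<and> {j. c j \<noteq> 0} \<subseteq> X \<and> (\<forall>j. c j \<in> R) \<and>
      s = (\<Sum>j | c j \<noteq> 0. act j (c j))"
  proof
    fix s assume "s \<in> S"
    then have "s \<in> M" using S(2) by blast
    then obtain c where "finite {j. c j \<noteq> 0}" "{j. c j \<noteq> 0} \<subseteq> X" "\<forall>j. c j \<in> R"
      "s = (\<Sum>j | c j \<noteq> 0. act j (c j))"
      by (rule basis_exists[OF X])
    thus "\<exists>c. finite {j. c j \<noteq> 0} \<and> {j. c j \<noteq> 0} \<subseteq> X \<and> (\<forall>j. c j \<in> R) \<and>
      s = (\<Sum>j | c j \<noteq> 0. act j (c j))"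
      by (intro exI[of _ c] conjI)
  qed
  from bchoice[OF this] obtain C where "\<forall>s\<in>S. finite {j. C s j \<noteq> 0} \<and> {j. C s j \<noteq> 0} \<subseteq> X \<and>
      (\<forall>j. C s j \<in> R) \<and> s = (\<Sum>j | C s j \<noteq> 0. act j (C s j))"
    by (elim exE)
  then have C: "finite {j. C s j \<noteq> 0}" "{j. C s j \<noteq> 0} \<subseteq> X" "C s j \<in> R"
    "s = (\<Sum>j | C s j \<noteq> 0. act j (C s j))" if "s \<in> S" for s j
    using that by (auto simp only:)
  define Y where "Y = (\<Union>s\<in>S. {j. C s j \<noteq> 0})"
  have Y: "finite Y" "Y \<subseteq> X" using S(1) C(1,2) unfolding Y_def by blast+
  have "X \<subseteq> Y"
  proof
    fix x assume x: "x \<in> X"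
    show "x \<in> Y"
    proof (rule ccontr)
      assume xY: "x \<notin> Y"
      obtain d where d: "\<And>s. s \<in> S \<Longrightarrow> d s \<in> R" "x = (\<Sum>s\<in>S. act s (d s))"
        using S(3)[of x] x XM by blast
      have "x = (\<Sum>s\<in>S. \<Sum>j\<in>Y. act j (C s j * d s))"
      proof (subst d(2), rule sum.cong[OF refl])
        fix s assume s: "s \<in> S"
        have "s = (\<Sum>j\<in>Y. act j (C s j))"
          by (rule trans[OF C(4)[OF s] sum_support_mono[OF Y(1)]])
            (use s Y XM in \<open>auto simp: Y_def\<close>)
        hence "act s (d s) = act (\<Sum>j\<in>Y. act j (C s j)) (d s)" by simp
        also have "\<dots> = (\<Sum>j\<in>Y. act (act j (C s j)) (d s))"
          by (rule act_sum_left) (use s d C Y XM act_closed in auto)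
        also have "\<dots> = (\<Sum>j\<in>Y. act j (C s j * d s))"
          by (rule sum.cong[OF refl], rule act_mult[symmetric]) (use s d C Y XM in auto)
        finally show "act s (d s) = (\<Sum>j\<in>Y. act j (C s j * d s))" .
      qed
      also have "\<dots> = (\<Sum>j\<in>Y. \<Sum>s\<in>S. act j (C s j * d s))" by (rule sum.swap)
      also have "\<dots> = (\<Sum>j\<in>Y. act j (\<Sum>s\<in>S. C s j * d s))"
        by (rule sum.cong[OF refl], rule act_sum_right[symmetric])
          (use d C Y XM ring_closed in auto)
      finally have x_Y: "(\<Sum>j\<in>Y. act j (\<Sum>s\<in>S. C s j * d s)) = x" by simp
      define c1 where "c1 j = (if j = x then 0 else \<Sum>s\<in>S. C s j * d s)" for j
      define c2 where "c2 j = (if j = x then 1 else (0::'r))" for j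
      have xM: "x \<in> M" using x XM by blast
      have "(\<Sum>j\<in>Y. act j (c1 j)) = (\<Sum>j\<in>Y. act j (\<Sum>s\<in>S. C s j * d s))"
        by (rule sum.cong[OF refl]) (use xY in \<open>auto simp: c1_def\<close>)
      hence "(\<Sum>j\<in>insert x Y. act j (c1 j)) = x"
        unfolding sum.insert[OF Y(1) xY] x_Y by (simp add: c1_def act_zero_right[OF xM])
      moreover have "(\<Sum>j\<in>Y. act j (c2 j)) = 0"
        by (rule sum.neutral) (use xY Y XM act_zero_right in \<open>auto simp: c2_def\<close>)
      hence "(\<Sum>j\<in>insert x Y. act j (c2 j)) = x"
        unfolding sum.insert[OF Y(1) xY] by (simp add: c2_def act_one[OF xM])
      moreover have "c1 j \<in> R" for j
        unfolding c1_def using d(1) C(3) ring_closed by (auto intro!: ring_sum_closed)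
      moreover have "c2 j \<in> R" for j unfolding c2_def using ring_closed by simp
      ultimately have "c1 x = c2 x"
        using Y x by (intro basis_unique[OF X, of "insert x Y"]) auto
      thus False by (simp add: c1_def c2_def)
    qed
  qed
  thus ?thesis using Y(1) finite_subset by blast
qed

lemma finite_basis_iso:
  assumes X: "right_module_basis R M act X (\<lambda>x. x)" and fin: "finite X"
  shows "module_iso R (free_pow R (card X + n)) pow_act (M \<times> free_pow R n) (sum_act act pow_act)"
proof -
  have XM: "X \<subseteq> M" using X unfolding right_module_basis_def by simp
  let ?k = "card X"
  obtain h where h: "bij_betw h {..<?k} X"
    using ex_bij_betw_nat_finite[OF fin] by (auto simp: atLeast0LessThan)
  have hX: "h i \<in> X" if "i < ?k" for i using bij_betwE[OF h] that by auto
  have hM: "h i \<in> M" if "i < ?k" for i using hX that XM by auto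
  define f where "f v = (\<Sum>i<?k. act (h i) (v i), \<lambda>i. v (?k + i))" for v :: "nat \<Rightarrow> 'r"
  have vR: "v i \<in> R" if "v \<in> free_pow R m" for v m i
    using that ring_closed by (cases "i < m") (auto simp: free_pow_def)
  have into: "f v \<in> M \<times> free_pow R n" if "v \<in> free_pow R (?k + n)" for v
    unfolding f_def using vR[OF that] that hM
    by (auto intro!: sum_closed act_closed simp: free_pow_def)
  have "inj_on f (free_pow R (?k + n))"
  proof (rule inj_onI, rule ext)
    fix v w i assume v: "v \<in> free_pow R (?k + n)" and w: "w \<in> free_pow R (?k + n)" and eq: "f v = f w"
    define u where "u = the_inv_into {..<?k} h"
    have u: "u (h i) = i" if "i < ?k" for i
      unfolding u_def using h that by (intro the_inv_into_f_f) (auto simp: bij_betw_def)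
    have re: "(\<Sum>j\<in>X. act j (v (u j))) = (\<Sum>i<?k. act (h i) (v i))" for v
      by (subst sum.reindex_bij_betw[OF h, symmetric]) (simp add: u)
    show "v i = w i"
    proof (cases "i < ?k")
      case True
      have "v (u (h i)) = w (u (h i))"
        by (rule basis_unique[OF X fin order_refl])
          (use vR[OF v] vR[OF w] re eq hX[OF True] in \<open>auto simp: f_def\<close>)
      thus ?thesis using u True by simp
    next
      case False
      have "v (?k + (i - ?k)) = w (?k + (i - ?k))" using eq unfolding f_def by (auto dest: fun_cong)
      thus ?thesis using False by simp
    qed
  qed
  moreover have "f ` free_pow R (?k + n) = M \<times> free_pow R n"
  proof (intro equalityI subsetI)
    fix p assume p: "p \<in> M \<times> free_pow R n"
    obtain x w where xw: "p = (x, w)" "x \<in> M" "w \<in> free_pow R n" using p by auto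
    obtain c where c: "{j. c j \<noteq> 0} \<subseteq> X" "\<forall>j. c j \<in> R" "x = (\<Sum>j | c j \<noteq> 0. act j (c j))"
      by (rule basis_exists[OF X xw(2)])
    define v where "v i = (if i < ?k then c (h i) else w (i - ?k))" for i
    have "v \<in> free_pow R (?k + n)"
      using c(2) vR[OF xw(3)] xw(3) by (auto simp: v_def free_pow_def)
    moreover have "f v = p"
      using c(3) sum_support_mono[OF fin c(1) XM] sum.reindex_bij_betw[OF h, of "\<lambda>j. act j (c j)"]
      by (simp add: f_def v_def xw)
    ultimately show "p \<in> f ` free_pow R (?k + n)" by blast
  qed (use into in blast)
  moreover have "f (v + w) = f v + f w"
    if "v \<in> free_pow R (?k + n)" "w \<in> free_pow R (?k + n)" for v w
    using vR[OF that(1)] vR[OF that(2)] hM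
    by (auto simp: f_def plus_fun_def act_add_right simp flip: sum.distrib)
  moreover have "f (pow_act v a) = sum_act act pow_act (f v) a"
    if "v \<in> free_pow R (?k + n)" "a \<in> R" for v a
    using vR[OF that(1)] that(2) hM
    by (auto simp: f_def pow_act_def sum_act_def act_mult act_closed intro!: act_sum_left[symmetric])
  ultimately show ?thesis unfolding module_iso_def bij_betw_def by blast
qed

end

lemma module_iso_trans:
  assumes "module_iso R M actM N actN" "module_iso R N actN L actL"
  shows "module_iso R M actM L actL"
proof -
  obtain f where f: "bij_betw f M N" "\<forall>x\<in>M. \<forall>y\<in>M. f (x + y) = f x + f y"
    "\<forall>x\<in>M. \<forall>a\<in>R. f (actM x a) = actN (f x) a"
    using assms(1) unfolding module_iso_def by blast
  obtain g where g: "bij_betw g N L" "\<forall>x\<in>N. \<forall>y\<in>N. g (x + y) = g x + g y"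
    "\<forall>x\<in>N. \<forall>a\<in>R. g (actN x a) = actL (g x) a"
    using assms(2) unfolding module_iso_def by blast
  show ?thesis unfolding module_iso_def
    using f g bij_betw_trans[OF f(1) g(1)] bij_betwE[OF f(1)]
    by (intro exI[of _ "g \<circ> f"]) simp
qed

lemma module_iso_sym:
  assumes "right_module R M actM" "module_iso R M actM N actN"
  shows "module_iso R N actN M actM"
proof -
  interpret right_module R M actM by fact
  obtain f where f: "bij_betw f M N" "\<forall>x\<in>M. \<forall>y\<in>M. f (x + y) = f x + f y"
    "\<forall>x\<in>M. \<forall>a\<in>R. f (actM x a) = actN (f x) a"
    using assms(2) unfolding module_iso_def by blast
  define g where "g = inv_into M f"
  have g: "bij_betw g N M" unfolding g_def by (rule bij_betw_inv_into[OF f(1)])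
  have gM: "g y \<in> M" if "y \<in> N" for y using bij_betwE[OF g] that by auto
  have fg: "f (g y) = y" if "y \<in> N" for y
    unfolding g_def using bij_betw_inv_into_right[OF f(1) that] .
  have gf: "g (f x) = x" if "x \<in> M" for x
    unfolding g_def using bij_betw_inv_into_left[OF f(1) that] .
  have "g (x + y) = g x + g y" if "x \<in> N" "y \<in> N" for x y
    using f(2) gM[OF that(1)] gM[OF that(2)] fg that gf[OF add_closed] by metis
  moreover have "g (actN x a) = actM (g x) a" if "x \<in> N" "a \<in> R" for x a
    using f(3) gM[OF that(1)] fg that gf[OF act_closed] by metis
  ultimately show ?thesis unfolding module_iso_def using g by blast
qed

lemma right_module_free_pow:
  assumes "is_subring R" shows "right_module R (free_pow R n) pow_act"
proof -
  have "right_module R R (*)"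
    using assms unfolding is_subring_def
    by unfold_locales (use assms in \<open>auto simp: algebra_simps, metis diff_self\<close>)
  then interpret right_module R R "(*)" .
  show ?thesis
    by unfold_locales
      (use assms diff_closed in \<open>auto simp: free_pow_def pow_act_def algebra_simps zero_closed act_closed\<close>)
qed

text \<open>The rank of a stably free module, computed from the free complement, is the cardinality of
  every basis.\<close>
lemma stably_free_basis_card:
  assumes ibn: "invariant_basis_number R" and "finitely_generated_module R M act"
    and iso: "module_iso R (M \<times> free_pow R n) (sum_act act pow_act) (free_pow R m) pow_act"
    and X: "right_module_basis R M act X (\<lambda>x. x)"
  shows "finite X" "card X + n = m"
proof -
  interpret right_module R M act using assms(2) unfolding finitely_generated_module_def by blast
  show fin: "finite X" by (rule finite_basis[OF assms(2) X])
  show "card X + n = m"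
    using ibn module_iso_trans[OF finite_basis_iso[OF X fin] iso]
    unfolding invariant_basis_number_def by blast
qed

lemma free_complement_of_rank_one_is_cyclic:
  assumes "invariant_basis_number R" "finitely_generated_module R M act"
    "module_iso R (M \<times> free_pow R 1) (sum_act act pow_act) (free_pow R 2) pow_act"
    and free: "free_module R M act"
  obtains x where "x \<in> M" "\<And>y. y \<in> M \<Longrightarrow> \<exists>a\<in>R. y = act x a"
proof -
  interpret right_module R M act using free unfolding free_module_def by blast
  obtain X where X: "right_module_basis R M act X (\<lambda>x. x)" using free unfolding free_module_def by blast
  have XM: "X \<subseteq> M" using X unfolding right_module_basis_def by simp
  have fin: "finite X" "card X = 1" using stably_free_basis_card[OF assms(1-3) X] by auto
  then obtain x where x: "X = {x}" using card_1_singletonE by blast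
  show ?thesis
  proof (rule that[of x])
    show "x \<in> M" using x XM by simp
    fix y assume "y \<in> M"
    then obtain c where c: "{j. c j \<noteq> 0} \<subseteq> X" "\<forall>j. c j \<in> R" "y = (\<Sum>j | c j \<noteq> 0. act j (c j))"
      by (rule basis_exists[OF X])
    show "\<exists>a\<in>R. y = act x a"
      using c(2,3) sum_support_mono[OF fin(1) c(1) XM] x by auto
  qed
qed

section \<open>The intersection ideal of a unimodular row\<close>

lemma right_module_right_ideal:
  assumes "right_ideal UNIV (P :: 'r::ring_1 set)" shows "right_module UNIV P (*)"
  using assms unfolding right_ideal_def
  by unfold_locales (auto simp: is_subring_def algebra_simps)

lemma right_ideal_intersection_principal:
  "right_ideal UNIV (range (\<lambda>x. r * x) \<inter> range (\<lambda>x. (s::'r::ring_1) * x))"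
proof -
  have "0 \<in> range (\<lambda>x. t * x)" for t :: 'r by (rule range_eqI[of _ _ 0]) simp
  moreover have "y - z \<in> range (\<lambda>x. t * x)"
    if "y \<in> range (\<lambda>x. t * x)" "z \<in> range (\<lambda>x. t * x)" for t y z :: 'r
    using that by (auto simp flip: right_diff_distrib)
  moreover have "y * a \<in> range (\<lambda>x. t * x)" if "y \<in> range (\<lambda>x. t * x)" for t y a :: 'r
    using that by (auto simp: mult.assoc)
  ultimately show ?thesis unfolding right_ideal_def by blast
qed

text \<open>The kernel of the map \<open>(a, b) \<mapsto> w = r a + s b\<close> is identified with \<open>P\<close> by \<open>(a, b) \<mapsto> r a = - s b\<close>,
  and the map has the section \<open>w \<mapsto> (u w, v w)\<close>. Subtracting the section gives the isomorphism
  \<open>f\<close> below, \<open>(a, b) \<mapsto> (r (a - u w), w)\<close>. The images of the standard basis generate \<open>P\<close>; up to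
  sign they are the two generators used below.\<close>
lemma intersection_of_unimodular_row:
  fixes r s u v :: "'r::ring_1"
  defines "P \<equiv> range (\<lambda>x. r * x) \<inter> range (\<lambda>x. s * x)"
  assumes row: "r * u + s * v = 1"
    and r: "\<And>x. r * x = 0 \<Longrightarrow> x = 0" and s: "\<And>x. s * x = 0 \<Longrightarrow> x = 0"
  shows "module_iso UNIV (P \<times> free_pow UNIV 1) (sum_act (*) pow_act) (free_pow UNIV 2) pow_act"
    and "finitely_generated_module UNIV P (*)"
proof -
  define w where "w a = r * a 0 + s * a 1" for a :: "nat \<Rightarrow> 'r"
  define f where "f a = (r * (a 0 - u * w a), \<lambda>i::nat. if i = 0 then w a else 0)" for a :: "nat \<Rightarrow> 'r"
  have sv: "s * v = 1 - r * u" using row by (simp add: algebra_simps)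
  have fP: "fst (f a) = s * (v * w a - a 1)" for a
  proof -
    have "s * (v * w a - a 1) = (s * v) * w a - s * a 1" by (simp add: algebra_simps)
    thus ?thesis unfolding sv by (simp add: f_def w_def algebra_simps)
  qed
  have fst_f: "fst (f a) \<in> P" for a
    unfolding P_def by (rule IntI, simp add: f_def, subst fP, simp)
  have into: "f a \<in> P \<times> free_pow UNIV 1" for a
    using fst_f[of a] by (simp add: mem_Times_iff) (simp add: f_def free_pow_def)
  have "inj_on f (free_pow UNIV 2)"
  proof (rule inj_onI)
    fix a b :: "nat \<Rightarrow> 'r"
    assume a: "a \<in> free_pow UNIV 2" and b: "b \<in> free_pow UNIV 2" and eq: "f a = f b"
    have "snd (f a) 0 = snd (f b) 0" using eq by simp
    hence w: "w a = w b" by (simp add: f_def)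
    have "r * (a 0 - b 0) = 0" using eq w by (simp add: f_def algebra_simps)
    hence 0: "a 0 = b 0" using r by fastforce
    have "s * (a 1 - b 1) = 0" using w 0 by (simp add: w_def algebra_simps)
    hence 1: "a 1 = b 1" using s by fastforce
    show "a = b"
    proof
      fix i :: nat
      consider "i = 0" | "i = 1" | "i \<ge> 2" by linarith
      thus "a i = b i" using 0 1 a b by cases (auto simp: free_pow_def)
    qed
  qed
  moreover have "f ` free_pow UNIV 2 = P \<times> free_pow UNIV 1"
  proof (intro equalityI subsetI)
    fix p assume "p \<in> P \<times> (free_pow UNIV 1 :: (nat \<Rightarrow> 'r) set)"
    then obtain x y b where xy: "p = (r * x, b)" "r * x = s * y" "b \<in> free_pow UNIV 1"
      unfolding P_def by auto
    define a where "a i = (if i = 0 then x + u * b 0 else if i = 1 then v * b 0 - y else 0)" for i :: nat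
    have "w a = (r * u + s * v) * b 0 + (r * x - s * y)"
      by (simp add: w_def a_def algebra_simps)
    hence w: "w a = b 0" using row xy by simp
    have "f a = p"
      using xy(1,3) by (auto simp: f_def w a_def free_pow_def)
    moreover have "a \<in> free_pow UNIV 2" by (simp add: a_def free_pow_def)
    ultimately show "p \<in> f ` free_pow UNIV 2" by blast
  qed (use into in blast)
  moreover have "f (a + b) = f a + f b" for a b
    by (auto simp: f_def w_def plus_fun_def algebra_simps)
  moreover have f_act: "f (pow_act a c) = sum_act (*) pow_act (f a) c" for a c
    by (auto simp: f_def w_def sum_act_def pow_act_def algebra_simps)
  ultimately have iso: "module_iso UNIV (free_pow UNIV 2) pow_act (P \<times> free_pow UNIV 1) (sum_act (*) pow_act)"
    unfolding module_iso_def bij_betw_def by blast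
  have "is_subring (UNIV :: 'r set)" by (simp add: is_subring_def)
  from module_iso_sym[OF right_module_free_pow[OF this] iso]
  show "module_iso UNIV (P \<times> free_pow UNIV 1) (sum_act (*) pow_act) (free_pow UNIV 2) pow_act" .
  have ri: "right_ideal UNIV P" unfolding P_def by (rule right_ideal_intersection_principal)
  have gens: "\<exists>a b. x = (r * (1 - u * r)) * a + (r * u * s) * b" if "x \<in> P" for x
  proof -
    have "x \<in> range (\<lambda>x. r * x)" "x \<in> range (\<lambda>x. s * x)" using \<open>x \<in> P\<close> unfolding P_def by auto
    then obtain y z where yz: "x = r * y" "x = s * z" by (elim imageE)
    have "(r * (1 - u * r)) * y + (r * u * s) * z = r * y - r * u * (r * y) + r * u * (s * z)"
      by (simp add: algebra_simps)
    also have "\<dots> = x" unfolding yz(1)[symmetric] yz(2)[symmetric] by simp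
    finally show ?thesis by metis
  qed
  show "finitely_generated_module UNIV P (*)"
    unfolding finitely_generated_module_def
  proof (intro conjI right_module_right_ideal ri exI[of _ "{r * (1 - u * r), r * u * s}"] ballI)
    have "r * u * s = s * (1 - v * s)"
    proof -
      have "s * (1 - v * s) = s - (s * v) * s" by (simp add: algebra_simps)
      thus ?thesis unfolding sv by (simp add: algebra_simps)
    qed
    moreover have "r * (1 - u * r) = s * (v * r)"
    proof -
      have "s * (v * r) = (s * v) * r" by (simp add: algebra_simps)
      thus ?thesis unfolding sv by (simp add: algebra_simps)
    qed
    ultimately show "{r * (1 - u * r), r * u * s} \<subseteq> P"
      unfolding P_def by (auto simp: mult.assoc) (metis mult.assoc rangeI)+
    fix x assume "x \<in> P"
    then obtain a b where x: "x = (r * (1 - u * r)) * a + (r * u * s) * b" using gens by blast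
    show "\<exists>c. (\<forall>t\<in>{r * (1 - u * r), r * u * s}. c t \<in> UNIV) \<and>
        x = (\<Sum>t\<in>{r * (1 - u * r), r * u * s}. t * c t)"
    \<comment> \<open>If the two generators coincide, the sum over the set of generators has one term only.\<close>
    proof (cases "r * (1 - u * r) = r * u * s")
      case True
      show ?thesis by (rule exI[of _ "\<lambda>_. a + b"]) (simp add: x True distrib_left)
    next
      case False
      show ?thesis
        by (rule exI[of _ "\<lambda>t. if t = r * (1 - u * r) then a else b"])
          (use False in \<open>auto simp: x\<close>)
    qed
  qed simp
qed

section \<open>Common right multiples in noetherian domains\<close>

text \<open>If \<open>p R\<close> and \<open>r R\<close> met only in \<open>0\<close>, the sum of the right ideals \<open>p\<^sup>n r R\<close> would be direct. The
  partial sums \<open>J n\<close>, built by \<open>J (n + 1) = r R + p (J n)\<close>, would then increase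
  strictly, since \<open>p\<^sup>n r\<close> lies in \<open>J (n + 1)\<close> but not in \<open>J n\<close>.\<close>
lemma right_Ore:
  assumes dom: "domain_on R" and acc: "ascending_chain_condition (right_ideal R)"
    and p: "p \<in> R" and r: "r \<in> R" "r \<noteq> 0"
  obtains t w where "t \<in> R" "t \<noteq> 0" "w \<in> R" "p * t = r * w"
proof (rule ccontr)
  assume "\<not> thesis"
  with that have no: "t = 0" if "p * t = r * w" "t \<in> R" "w \<in> R" for t w using that by blast
  have "is_subring R" using dom unfolding domain_on_def by blast
  then have 1: "1 \<in> R" and d: "\<And>x y. x \<in> R \<Longrightarrow> y \<in> R \<Longrightarrow> x - y \<in> R"
    and m: "\<And>x y. x \<in> R \<Longrightarrow> y \<in> R \<Longrightarrow> x * y \<in> R"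
    unfolding is_subring_def by auto
  have R0: "0 \<in> R" using d[OF 1 1] by simp
  have a: "x + y \<in> R" if "x \<in> R" "y \<in> R" for x y using d[OF that(1) d[OF R0 that(2)]] by simp
  define J where "J = rec_nat {0} (\<lambda>_ K. {r * a + p * x | a x. a \<in> R \<and> x \<in> K})"
  have J0: "J 0 = {0}" and JS: "J (Suc n) = {r * a + p * x | a x. a \<in> R \<and> x \<in> J n}" for n
    by (simp_all add: J_def)
  have ideal: "right_ideal R (J n)" for n
  proof (induction n)
    case 0
    show ?case using R0 by (simp add: right_ideal_def J0)
  next
    case (Suc n)
    note IH = Suc[unfolded right_ideal_def]
    show ?case
      unfolding right_ideal_def
    proof (intro conjI ballI subsetI)
      fix z assume "z \<in> J (Suc n)"
      then obtain a1 x where z: "z = r * a1 + p * x" "a1 \<in> R" "x \<in> J n" unfolding JS by blast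
      have "x \<in> R" using z(3) IH by (elim conjE) (rule subsetD)
      thus "z \<in> R" unfolding z(1) by (intro a m p r z)
      show "z * b \<in> J (Suc n)" if "b \<in> R" for b
        unfolding JS using z that m IH
        by (intro CollectI exI[of _ "a1 * b"] exI[of _ "x * b"]) (auto simp: algebra_simps)
      fix z' assume "z' \<in> J (Suc n)"
      then obtain a2 x' where z': "z' = r * a2 + p * x'" "a2 \<in> R" "x' \<in> J n" unfolding JS by blast
      show "z - z' \<in> J (Suc n)"
        unfolding JS using z z' d IH
        by (intro CollectI exI[of _ "a1 - a2"] exI[of _ "x - x'"]) (auto simp: algebra_simps)
    next
      show "0 \<in> J (Suc n)"
        unfolding JS using R0 IH by (intro CollectI exI[of _ 0]) auto
    qed
  qed
  have JR: "J n \<subseteq> R" for n using ideal[of n] by (simp add: right_ideal_def)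
  have "J n \<subseteq> J (Suc n)" for n
  proof (induction n)
    case 0
    show ?case unfolding J0 using ideal[of "Suc 0"] by (simp add: right_ideal_def)
  next
    case (Suc n)
    show ?case
    proof
      fix z assume "z \<in> J (Suc n)"
      then obtain a x where z: "z = r * a + p * x" "a \<in> R" "x \<in> J n" by (subst (asm) JS) blast
      thus "z \<in> J (Suc (Suc n))" using Suc by (subst JS) blast
    qed
  qed
  with ideal acc obtain N where N: "\<And>n. n \<ge> N \<Longrightarrow> J n = J N"
    unfolding ascending_chain_condition_def by blast
  have pow: "p ^ n * r \<in> R" for n by (induction n) (use p r m in \<open>auto simp: mult.assoc\<close>)
  have "p ^ n * r \<in> J (Suc n)" for n
  proof (induction n)
    case 0
    show ?case unfolding JS J0 using 1 by (intro CollectI exI[of _ 1] exI[of _ 0]) auto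
  next
    case (Suc n)
    show ?case
      using Suc R0 by (subst JS, intro CollectI exI[of _ 0] exI[of _ "p ^ n * r"]) (auto simp: mult.assoc)
  qed
  moreover have "p ^ n * r \<notin> J n" for n
  proof (induction n)
    case 0
    show ?case using r by (simp add: J0)
  next
    case (Suc n)
    show ?case
    proof
      assume "p ^ Suc n * r \<in> J (Suc n)"
      then obtain a x where ax: "p * (p ^ n * r) = r * a + p * x" "a \<in> R" "x \<in> J n"
        unfolding JS by (auto simp: mult.assoc)
      hence "p * (p ^ n * r - x) = r * a" by (simp add: algebra_simps)
      hence "p ^ n * r - x = 0" using no ax pow d JR by blast
      thus False using Suc ax(3) by simp
    qed
  qed
  ultimately show False using N[of "Suc N"] by (metis le_SucI order_refl)
qed

context domain_crossed_product
begin

section \<open>The intersection ideal is not principal\<close>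

text \<open>Reduce \<open>x\<close> modulo \<open>r B\<close>. If \<open>x\<close> has degree \<open>n\<close>, then \<open>x s = 1 + r y\<close> has all its coefficients of
  degree \<open>n + 1\<close> in \<open>r A\<close>, hence so has \<open>x\<close> in degree \<open>n\<close>, and subtracting a multiple of
  \<open>r\<close> lowers the degree of \<open>x\<close>. In the end \<open>x = 0\<close>, which makes \<open>r\<close> right invertible.\<close>
lemma no_left_inverse_modulo:
  assumes r: "r \<in> A" "r \<noteq> 0" "\<not> unit_in A r"
    and s: "s \<in> degree_below (Suc 1)" and lead: "coef s {#i#} = scaleB c 1" "c \<noteq> 0"
  shows "x * s \<noteq> 1 + r * y"
proof -
  have "x * s \<noteq> 1 + r * y" if "x \<in> degree_below n" for n x y
    using that
  proof (induction n arbitrary: x y)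
    case 0
    hence x: "x = 0" using coef_eq_zero_iff[of x] by (simp add: degree_below_def)
    show ?case
    proof
      assume "x * s = 1 + r * y"
      hence "1 = - (r * y)" unfolding x by (simp add: eq_neg_iff_add_eq_0)
      hence "r * (- y) = 1" by simp
      thus False using right_unit_in_A r by blast
    qed
  next
    case (Suc n)
    show ?case
    proof
      assume eq: "x * s = 1 + r * y"
      have xs: "x * s \<in> degree_below (Suc (Suc n))"
        using word_span_mult[of x n s "Suc 1"] Suc.prems s by (simp add: word_span_eq_degree_below)
      have one: "- 1 \<in> degree_below (Suc (Suc n))"
        using degree_below_one[of "- 1"] degree_below_mono[of "- 1" 1] by simp
      have "r * y = x * s + - 1" using eq by simp
      hence "r * y \<in> degree_below (Suc (Suc n))" using degree_below_add[OF xs one] by simp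
      hence y: "y \<in> degree_below (Suc (Suc n))" using degree_below_factor r(2) by blast
      have top: "coef x j \<in> (*) r ` A" if "size j = n" for j
      proof (rule linear_factor_cancels_modulo_right_ideal[OF Suc.prems s lead _ _ _ _ that])
        show "0 \<in> (*) r ` A" by (rule image_eqI[of _ _ 0]) auto
        show "a - b \<in> (*) r ` A" if "a \<in> (*) r ` A" "b \<in> (*) r ` A" for a b
          using that by (auto simp flip: right_diff_distrib)
        show "a * b \<in> (*) r ` A" if "a \<in> (*) r ` A" "b \<in> A" for a b
          using that by (auto simp: mult.assoc)
        fix l :: "'i multiset" assume l: "size l = Suc n"
        have "coef (x * s) l = r * coef y l"
          using l coef_mult_left_top[OF r(1) y l] by (auto simp: eq coef_A)
        thus "coef (x * s) l \<in> (*) r ` A" by auto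
      qed
      define J where "J = {j. coef x j \<noteq> 0 \<and> size j = n}"
      have J: "finite J" by (rule finite_subset[OF _ finite_coef[of x]]) (auto simp: J_def)
      have "\<forall>j. \<exists>d. size j = n \<longrightarrow> d \<in> A \<and> coef x j = r * d" using top by blast
      then obtain d where d: "\<And>j. size j = n \<Longrightarrow> d j \<in> A" "\<And>j. size j = n \<Longrightarrow> coef x j = r * d j"
        using choice by metis
      \<comment> \<open>The product \<open>r t\<close> has the same coefficients of degree \<open>n\<close> as \<open>x\<close>.\<close>
      define t where "t = (\<Sum>j\<in>J. monomial j * d j)"
      have mono: "set_mset j \<subseteq> I" if "j \<in> J" for j using that coef_outside by (auto simp: J_def)
      have t_coef: "coef t k = (if k \<in> J then d k else 0)" for k
      proof -
        have "coef t k = (\<Sum>j\<in>J. if k = j then d j else 0)"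
          unfolding t_def coef_sum
          by (rule sum.cong[OF refl], rule coef_monomial) (use mono d in \<open>auto simp: J_def\<close>)
        thus ?thesis using J by simp
      qed
      have t: "t \<in> degree_below (Suc n)" by (auto simp: degree_below_def t_coef J_def split: if_splits)
      have "x - r * t \<in> degree_below n"
        unfolding degree_below_def
      proof (intro CollectI allI impI)
        fix k assume k: "coef (x - r * t) k \<noteq> 0"
        have "r * t \<in> degree_below (0 + Suc n)"
          using word_span_mult[of r 0 t "Suc n"] t degree_below_one r(1)
          by (simp add: word_span_eq_degree_below)
        hence "size k < Suc n" using k Suc.prems by (auto simp: degree_below_def) (metis diff_self)
        moreover have "size k \<noteq> n"
        proof
          assume sz: "size k = n"
          have "coef (r * t) k = r * coef t k" by (rule coef_mult_left_top[OF r(1) t sz])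
          also have "\<dots> = coef x k" using d(2)[OF sz] sz by (simp add: t_coef J_def)
          finally show False using k by simp
        qed
        ultimately show "size k < n" by linarith
      qed
      moreover have "(x - r * t) * s = 1 + r * (y - t * s)"
        by (simp add: left_diff_distrib right_diff_distrib eq mult.assoc)
      ultimately show False using Suc.IH by blast
    qed
  qed
  thus ?thesis using in_some_degree_below by blast
qed

text \<open>A generator \<open>f = s b\<close> would have degree one with \<open>b \<in> r A\<close>, and then \<open>v\<close> would be inverse to \<open>s\<close>
  modulo \<open>r B\<close>.\<close>
lemma intersection_not_principal:
  assumes acc: "ascending_chain_condition (right_ideal A)"
    and r: "r \<in> A" "\<not> unit_in A r" and q: "q \<in> A" and h: "h \<noteq> 0"
    and row: "r * u + (bar h + q) * v = 1"
  shows "\<nexists>f. range (\<lambda>x. r * x) \<inter> range (\<lambda>x. (bar h + q) * x) = range (\<lambda>x. f * x)"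
proof
  define s where "s = bar h + q"
  assume "\<exists>f. range (\<lambda>x. r * x) \<inter> range (\<lambda>x. (bar h + q) * x) = range (\<lambda>x. f * x)"
  then obtain f where f: "range (\<lambda>x. r * x) \<inter> range (\<lambda>x. s * x) = range (\<lambda>x. f * x)"
    unfolding s_def by blast
  obtain i c where bar_c: "coef (bar h) {#i#} = scaleB c 1" "c \<noteq> 0"
    using bar_leading_scalar[OF h] by blast
  have s_deg: "s \<in> degree_below (Suc 1)"
    unfolding s_def
    using bar_in_word_span[of h] degree_below_one[of q] q
    by (intro degree_below_add) (auto simp: word_span_eq_degree_below intro: degree_below_mono)
  have lead: "coef s {#i#} = scaleB c 1" unfolding s_def using bar_c q by (simp add: coef_A)
  have "scaleB c 1 \<noteq> 0" using scalar_cancel[OF bar_c(2), of 1] by auto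
  hence sA: "s \<notin> A" using lead coef_A[of s "{#i#}"] by auto
  hence s0: "s \<noteq> 0" by auto
  have r0: "r \<noteq> 0"
  proof
    assume "r = 0"
    hence sv: "s * v = 1" using row by (simp add: s_def)
    hence "v \<noteq> 0" by auto
    thus False using factors_in_A(1)[of s v] sv s0 sA by simp
  qed
  have "f \<in> range (\<lambda>x. f * x)" by (rule range_eqI[of _ _ 1]) simp
  then obtain a b where fa: "f = r * a" and fb: "f = s * b" unfolding f[symmetric] by blast
  obtain t w where tw: "t \<in> A" "t \<noteq> 0" "w \<in> A" "((bar h * r - r * bar h) + q * r) * t = r * w"
    by (rule right_Ore[OF domain acc, of "(bar h * r - r * bar h) + q * r" r]) (use r r0 q in auto)
  \<comment> \<open>An element of degree one in the intersection, which bounds the degree of \<open>f\<close>.\<close>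
  have "s * (r * t) = r * (bar h * t + w)"
    using tw(4) by (simp add: s_def algebra_simps)
  hence "s * (r * t) \<in> range (\<lambda>x. f * x)" unfolding f[symmetric] by blast
  then obtain z where "s * (r * t) = s * (b * z)" unfolding fb by (auto simp: mult.assoc)
  hence rt: "r * t = b * z" using left_cancel s0 by blast
  have "r * t \<noteq> 0" using no_zero_divisors r0 tw(2) by blast
  hence "b \<noteq> 0" "z \<noteq> 0" unfolding rt by auto
  hence bA: "b \<in> A" using factors_in_A(1)[of b z] r(1) tw(1) unfolding rt[symmetric] by blast
  have s_eq: "s * b = r * a" using fa fb by simp
  obtain b' where b': "b = r * b'"
  proof -
    have sb: "s * b \<in> degree_below (Suc 1)" using s_deg bA by (rule degree_below_mult_right)
    hence a: "a \<in> degree_below (Suc 1)" using degree_below_factor r0 unfolding s_eq by blast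
    have "coef (s * b) {#i#} = r * coef a {#i#}"
      unfolding s_eq by (rule coef_mult_left_top[OF r(1) a]) simp
    moreover have "coef (s * b) {#i#} = b * scaleB c 1"
      using coef_mult_right[OF bA, of s "{#i#}"] lead by (metis scale_eq_mult)
    ultimately have "b * scaleB c 1 * scaleB (inverse c) 1 = r * (coef a {#i#} * scaleB (inverse c) 1)"
      by (simp add: mult.assoc)
    thus ?thesis using that scalar_cancel[OF bar_c(2)] by simp
  qed
  \<comment> \<open>A second element of the intersection; being in \<open>s b B\<close>, it shows that \<open>1 - v s\<close> is in \<open>b B\<close>.\<close>
  have "s * (1 - v * s) = s - (s * v) * s" by (simp add: algebra_simps)
  also have "s * v = 1 - r * u" using row by (simp add: s_def algebra_simps)
  finally have "s * (1 - v * s) = r * (u * s)" by (simp add: algebra_simps)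
  hence "s * (1 - v * s) \<in> range (\<lambda>x. f * x)" unfolding f[symmetric] by blast
  then obtain y where "s * (1 - v * s) = s * (b * y)" unfolding fb by (auto simp: mult.assoc)
  hence "1 - v * s = r * (b' * y)" using left_cancel s0 b' by (metis mult.assoc)
  hence "v * s = 1 + r * (- (b' * y))" by (simp add: algebra_simps)
  thus False using no_left_inverse_modulo[OF r(1) r0 r(2) s_deg lead bar_c(2)] by blast
qed

end

theorem theorem6p3:
  fixes scaleB :: "'k::field \<Rightarrow> 'b::ring_1 \<Rightarrow> 'b"
    and scaleG :: "'k \<Rightarrow> 'g::ab_group_add \<Rightarrow> 'g"
    and bracket :: "'g \<Rightarrow> 'g \<Rightarrow> 'g"
    and A :: "'b set"
    and I :: "'i::linorder set"
    and e :: "'i \<Rightarrow> 'g"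
    and bar :: "'g \<Rightarrow> 'b"
    and g :: 'g
    and r q :: 'b
  assumes "crossed_product scaleB scaleG bracket A I e bar"
    and "domain_on A"
    and "noetherian_on A"
    and "invariant_basis_number A"
    and "invariant_basis_number (adjoin scaleB A (bar g))"
    and "invariant_basis_number (UNIV :: 'b set)"
    and "g \<noteq> 0"
    and "r \<in> A"
    and "q \<in> A"
    and "\<not> unit_in A r"
    and "unimodular_row2 (adjoin scaleB A (bar g)) r (bar g + q)"
  shows "right_ideal UNIV (range (\<lambda>x. r * x) \<inter> range (\<lambda>x. (bar g + q) * x)) \<and>
    stably_free_module UNIV (range (\<lambda>x. r * x) \<inter> range (\<lambda>x. (bar g + q) * x)) (*) \<and>
    \<not> free_module UNIV (range (\<lambda>x. r * x) \<inter> range (\<lambda>x. (bar g + q) * x)) (*)"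
proof -
  interpret domain_crossed_product scaleB scaleG bracket A I e bar
    using assms(1,2) by (simp add: domain_crossed_product_def domain_crossed_product_axioms_def)
  let ?s = "bar g + q"
  let ?P = "range (\<lambda>x. r * x) \<inter> range (\<lambda>x. ?s * x)"
  let ?A1 = "adjoin scaleB A (bar g)"
  have "1 \<in> ?A1"
    unfolding adjoin_def by (rule hull_inc) simp
  hence "1 \<in> {r * a + ?s * b | a b. a \<in> ?A1 \<and> b \<in> ?A1}"
    using assms(11) unfolding unimodular_row2_def by simp
  then obtain u v where row: "r * u + ?s * v = 1"
    by (auto dest: sym)
  have acc: "ascending_chain_condition (right_ideal A)"
    using assms(3) unfolding noetherian_on_def by blast
  have not_principal: "?P \<noteq> range (\<lambda>x. f * x)" for f
    using intersection_not_principal[OF acc assms(8,10,9,7) row] by blast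
  have zero: "range (\<lambda>x. 0 * x) = {0 :: 'b}" by auto
  have mem: "0 \<in> range (\<lambda>x. t * x)" for t :: 'b by (rule range_eqI[of _ _ 0]) simp
  have r: "r \<noteq> 0" using not_principal[of 0] mem[of ?s] unfolding zero by (auto simp: zero)
  have s: "?s \<noteq> 0" using not_principal[of 0] mem[of r] unfolding zero by (auto simp: zero)
  have cancel: "\<And>x. r * x = 0 \<Longrightarrow> x = 0" "\<And>x. ?s * x = 0 \<Longrightarrow> x = 0"
    using no_zero_divisors r s by blast+
  note splitting = intersection_of_unimodular_row[OF row cancel]
  have ideal: "right_ideal UNIV ?P" by (rule right_ideal_intersection_principal)
  moreover have "stably_free_module UNIV ?P (*)"
    unfolding stably_free_module_def using splitting by blast
  moreover have "\<not> free_module UNIV ?P (*)"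
  proof
    assume "free_module UNIV ?P (*)"
    then obtain f where f: "f \<in> ?P" "\<And>y. y \<in> ?P \<Longrightarrow> \<exists>a\<in>UNIV. y = f * a"
      using free_complement_of_rank_one_is_cyclic[OF assms(6) splitting(2,1)] by blast
    have "?P = range (\<lambda>x. f * x)"
    proof (intro equalityI subsetI)
      show "y \<in> range (\<lambda>x. f * x)" if "y \<in> ?P" for y using f(2)[OF that] by auto
      have "f * a \<in> ?P" for a using ideal f(1) unfolding right_ideal_def by simp
      thus "y \<in> ?P" if "y \<in> range (\<lambda>x. f * x)" for y using that by auto
    qed
    thus False using not_principal by blast
  qed
  ultimately show ?thesis by blast
qed

end
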